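(* Let $T$ be a $d$-regular rooted tree ($d\geq 2$) and let $G\le\mathrm{Aut}(T)$ be a finitely generated self-similar branch group with the congruence subgroup property. If $G$ has the subgroup induction property, then $G$ is subgroup separable, i.e. every finitely generated subgroup of $G$ is closed in the profinite topology of $G$.
   Context: The vertices of $T$ are the finite words over $\{0,\dots,d-1\}$, the root is the empty word, and $\mathcal L_n$ is the set of words of length $n$. $T_v$ is the subtree of all words with prefix $v$, naturally identified with $T$. $\mathrm{Aut}(T)$ is the group of root-preserving graph automorphisms. For $G\le\mathrm{Aut}(T)$, $\mathrm{Stab}_G(v)$ is the stabilizer of $v$, $\mathrm{Stab}_G(\mathcal L_n)=\bigcap_{v\in\mathcal L_n}\mathrm{Stab}_G(v)$, $\mathrm{Rist}_G(v)=\bigcap_{w\notin T_v}\mathrm{Stab}_G(w)$ and $\mathrm{Rist}_G(n)=\prod_{v\in\mathcal L_n}\mathrm{Rist}_G(v)$. The map $\varphi_v\colon \mathrm{Stab}_{\mathrm{Aut}(T)}(v)\to\mathrm{Aut}(T_v)$ is restriction to $T_v$, and $\varphi_v(G)$ is shorthand for $\varphi_v(\mathrm{Stab}_G(v))$. $G$ is branch if it acts transitively on every $\mathcal L_n$ and every $\mathrm{Rist}_G(n)$ has finite index in $G$. $G$ is self-similar if for every vertex $v$, $\varphi_v(G)$ is a subgroup of $G$ under the identification of $T_v$ with $T$. A branch group $G$ has the congruence subgroup property if every finite index subgroup of $G$ contains $\mathrm{Stab}_G(\mathcal L_n)$ for some $n$. For $G$ self-similar, a family $\mathcal X$ of subgroups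 of $G$ is inductive if: (I) $\{1\}$ and $G$ belong to $\mathcal X$; (II) if $H\le L$ are subgroups of $G$ with $[L:H]$ finite, then $L\in\mathcal X$ if and only if $H\in\mathcal X$; (III) if $H$ is a finitely generated subgroup of $\mathrm{Stab}_G(\mathcal L_1)$ and all first level sections $\varphi_v(H)$, $v\in\mathcal L_1$ (viewed as subgroups of $G$), are in $\mathcal X$, then $H\in\mathcal X$. $G$ has the subgroup induction property if for every inductive family $\mathcal X$, each finitely generated subgroup of $G$ belongs to $\mathcal X$. *)

theory Defs
  imports "HOL-Analysis.Abstract_Topology" "HOL-Algebra.Bij" "HOL-Algebra.Coset"
    "HOL-Algebra.Generated_Groups"
begin

section \<open>Groups: finite index, finite generation, profinite topology\<close>

definition finite_index :: "('a, 'b) monoid_scheme \<Rightarrow> 'a set \<Rightarrow> bool" where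
  "finite_index \<Gamma> H \<longleftrightarrow> finite (rcosets\<^bsub>\<Gamma>\<^esub> H)"

definition fin_gen :: "('a, 'b) monoid_scheme \<Rightarrow> 'a set \<Rightarrow> bool" where
  "fin_gen \<Gamma> H \<longleftrightarrow> (\<exists>S. finite S \<and> S \<subseteq> carrier \<Gamma> \<and> H = generate \<Gamma> S)"

text \<open>The cosets below form a base, so the generated topology consists of their unions.\<close>

definition profinite_topology :: "('a, 'b) monoid_scheme \<Rightarrow> 'a topology" where
  "profinite_topology \<Gamma> =
     topology_generated_by
       {N #>\<^bsub>\<Gamma>\<^esub> x | N x. N \<lhd> \<Gamma> \<and> finite_index \<Gamma> N \<and> x \<in> carrier \<Gamma>}"

definition subgroup_separable :: "('a, 'b) monoid_scheme \<Rightarrow> bool" where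
  "subgroup_separable \<Gamma> \<longleftrightarrow>
     (\<forall>H. subgroup H \<Gamma> \<and> fin_gen \<Gamma> H \<longrightarrow> closedin (profinite_topology \<Gamma>) H)"


section \<open>The regular rooted tree and its automorphism group\<close>

definition vertices :: "nat \<Rightarrow> nat list set" where
  "vertices d = lists {..<d}"

definition level :: "nat \<Rightarrow> nat \<Rightarrow> nat list set" where
  "level d n = {v \<in> vertices d. length v = n}"

definition subtree :: "nat \<Rightarrow> nat list \<Rightarrow> nat list set" where
  "subtree d v = {v @ w | w. w \<in> vertices d}"

definition adjacent :: "nat list \<Rightarrow> nat list \<Rightarrow> bool" where
  "adjacent u v \<longleftrightarrow> (\<exists>x. v = u @ [x] \<or> u = v @ [x])"

text \<open>As in \<^const>\<open>BijGroup\<close>, an automorphism is \<^term>\<open>undefined\<close> outside the vertex set, and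
  the product is composition of maps.\<close>

definition Aut_tree :: "nat \<Rightarrow> (nat list \<Rightarrow> nat list) monoid" where
  "Aut_tree d = BijGroup (vertices d)
     \<lparr>carrier := {f \<in> Bij (vertices d). f [] = [] \<and>
        (\<forall>u\<in>vertices d. \<forall>v\<in>vertices d. adjacent (f u) (f v) \<longleftrightarrow> adjacent u v)}\<rparr>"

abbreviation grp :: "nat \<Rightarrow> (nat list \<Rightarrow> nat list) set \<Rightarrow> (nat list \<Rightarrow> nat list) monoid" where
  "grp d G \<equiv> Aut_tree d\<lparr>carrier := G\<rparr>"


section \<open>Stabilizers, rigid stabilizers, sections\<close>

definition stab :: "(nat list \<Rightarrow> nat list) set \<Rightarrow> nat list \<Rightarrow> (nat list \<Rightarrow> nat list) set" where
  "stab G v = {g \<in> G. g v = v}"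

definition stab_level ::
    "nat \<Rightarrow> (nat list \<Rightarrow> nat list) set \<Rightarrow> nat \<Rightarrow> (nat list \<Rightarrow> nat list) set" where
  "stab_level d G n = {g \<in> G. \<forall>v\<in>level d n. g v = v}"

text \<open>For the root there is no vertex outside the subtree, and the intersection of stabilizers is
  then \<open>G\<close> itself.\<close>

definition rist ::
    "nat \<Rightarrow> (nat list \<Rightarrow> nat list) set \<Rightarrow> nat list \<Rightarrow> (nat list \<Rightarrow> nat list) set" where
  "rist d G v = {g \<in> G. \<forall>w \<in> vertices d - subtree d v. g w = w}"

text \<open>Rigid stabilizers of distinct vertices of a level commute (\<open>rist_commute\<close> below), so their
  product inside \<open>G\<close> is the subgroup generated by them.\<close>

definition rist_level ::
    "nat \<Rightarrow> (nat list \<Rightarrow> nat list) set \<Rightarrow> nat \<Rightarrow> (nat list \<Rightarrow> nat list) set" where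
  "rist_level d G n = generate (Aut_tree d) (\<Union>v\<in>level d n. rist d G v)"

text \<open>The restriction of \<open>g\<close> to the subtree at a fixed vertex \<open>v\<close>, transported to the whole tree
  along \<open>w \<mapsto> v @ w\<close>; only meaningful when \<open>g\<close> fixes \<open>v\<close>.\<close>

definition sec :: "nat \<Rightarrow> nat list \<Rightarrow> (nat list \<Rightarrow> nat list) \<Rightarrow> nat list \<Rightarrow> nat list" where
  "sec d v g = (\<lambda>w\<in>vertices d. drop (length v) (g (v @ w)))"

definition secs ::
    "nat \<Rightarrow> nat list \<Rightarrow> (nat list \<Rightarrow> nat list) set \<Rightarrow> (nat list \<Rightarrow> nat list) set" where
  "secs d v G = sec d v ` stab G v"


section \<open>Properties of groups of tree automorphisms\<close>

definition branch :: "nat \<Rightarrow> (nat list \<Rightarrow> nat list) set \<Rightarrow> bool" where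
  "branch d G \<longleftrightarrow>
     (\<forall>n. \<forall>u\<in>level d n. \<forall>v\<in>level d n. \<exists>g\<in>G. g u = v) \<and>
     (\<forall>n. finite_index (grp d G) (rist_level d G n))"

definition self_similar :: "nat \<Rightarrow> (nat list \<Rightarrow> nat list) set \<Rightarrow> bool" where
  "self_similar d G \<longleftrightarrow> (\<forall>v\<in>vertices d. subgroup (secs d v G) (grp d G))"

definition congruence_subgroup_property :: "nat \<Rightarrow> (nat list \<Rightarrow> nat list) set \<Rightarrow> bool" where
  "congruence_subgroup_property d G \<longleftrightarrow>
     (\<forall>H. subgroup H (grp d G) \<and> finite_index (grp d G) H \<longrightarrow> (\<exists>n. stab_level d G n \<subseteq> H))"

definition inductive_family ::
    "nat \<Rightarrow> (nat list \<Rightarrow> nat list) set \<Rightarrow> (nat list \<Rightarrow> nat list) set set \<Rightarrow> bool" where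
  "inductive_family d G \<X> \<longleftrightarrow>
     (\<forall>H\<in>\<X>. subgroup H (grp d G)) \<and>
     {\<one>\<^bsub>grp d G\<^esub>} \<in> \<X> \<and> G \<in> \<X> \<and>
     (\<forall>H L. subgroup H (grp d G) \<and> subgroup L (grp d G) \<and> H \<subseteq> L \<and> finite_index (grp d L) H
        \<longrightarrow> (L \<in> \<X> \<longleftrightarrow> H \<in> \<X>)) \<and>
     (\<forall>H. subgroup H (grp d G) \<and> fin_gen (grp d G) H \<and> H \<subseteq> stab_level d G 1
        \<and> (\<forall>v\<in>level d 1. secs d v H \<in> \<X>) \<longrightarrow> H \<in> \<X>)"

definition subgroup_induction_property :: "nat \<Rightarrow> (nat list \<Rightarrow> nat list) set \<Rightarrow> bool" where
  "subgroup_induction_property d G \<longleftrightarrow>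
     (\<forall>\<X>. inductive_family d G \<X> \<longrightarrow>
        (\<forall>H. subgroup H (grp d G) \<and> fin_gen (grp d G) H \<longrightarrow> H \<in> \<X>))"


section \<open>Basic facts\<close>

lemma group_Aut_tree: "group (Aut_tree d)"
proof -
  let ?V = "vertices d" and ?B = "BijGroup (vertices d)" and ?A = "carrier (Aut_tree d)"
  have A: "?A = {f \<in> Bij ?V. f [] = [] \<and> (\<forall>u\<in>?V. \<forall>v\<in>?V. adjacent (f u) (f v) \<longleftrightarrow> adjacent u v)}"
    by (simp add: Aut_tree_def)
  have nil: "[] \<in> ?V" by (simp add: vertices_def)
  interpret B: group ?B by (rule group_BijGroup)
  have "subgroup ?A ?B"
  proof (rule B.subgroupI)
    show "?A \<subseteq> carrier ?B" by (auto simp: A BijGroup_def)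
    have "(\<lambda>x\<in>?V. x) \<in> ?A" using nil id_Bij[of ?V] by (auto simp: A)
    then show "?A \<noteq> {}" by blast
  next
    fix f assume f: "f \<in> ?A"
    then have fb: "f \<in> Bij ?V" and f0: "f [] = []" by (auto simp: A)
    have inv: "inv\<^bsub>?B\<^esub> f = (\<lambda>x\<in>?V. inv_into ?V f x)"
      using fb by (rule inv_BijGroup)
    have bij: "bij_betw f ?V ?V" using fb by (simp add: Bij_def)
    have mem: "inv_into ?V f x \<in> ?V" if "x \<in> ?V" for x
      using Bij_inv_into_mem[OF fb that] .
    have r: "f (inv_into ?V f x) = x" if "x \<in> ?V" for x
      using bij that by (simp add: bij_betw_def f_inv_into_f)
    have n: "inv_into ?V f [] = []"
      using bij nil f0 by (metis bij_betw_inv_into_left)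
    show "inv\<^bsub>?B\<^esub> f \<in> ?A"
      unfolding inv using f mem r n nil restrict_inv_into_Bij[OF fb] by (auto simp: A) metis+
  next
    fix f g assume f: "f \<in> ?A" and g: "g \<in> ?A"
    then have fb: "f \<in> Bij ?V" and gb: "g \<in> Bij ?V" by (auto simp: A)
    have mem: "g x \<in> ?V" if "x \<in> ?V" for x
      using Bij_imp_funcset[OF gb] that by auto
    show "f \<otimes>\<^bsub>?B\<^esub> g \<in> ?A"
      using f g fb gb compose_Bij[OF fb gb] mem nil
      by (auto simp: A BijGroup_def compose_def)
  qed
  then have "group (?B\<lparr>carrier := ?A\<rparr>)"
    by (rule B.subgroup_imp_group)
  moreover have "?B\<lparr>carrier := ?A\<rparr> = Aut_tree d"
    by (simp add: Aut_tree_def)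
  ultimately show ?thesis by simp
qed

lemma rist_commute:
  assumes G: "subgroup G (Aut_tree d)" and uv: "u \<in> level d n" "v \<in> level d n" "u \<noteq> v"
    and g: "g \<in> rist d G u" and h: "h \<in> rist d G v"
  shows "g \<otimes>\<^bsub>Aut_tree d\<^esub> h = h \<otimes>\<^bsub>Aut_tree d\<^esub> g"
proof -
  let ?V = "vertices d"
  have B: "k \<in> Bij ?V" if "k \<in> rist d G a" for k a
    using that subgroup.subset[OF G] by (auto simp: rist_def Aut_tree_def)
  have disj: "w \<notin> subtree d v" if "w \<in> subtree d u" for w
    using that uv by (auto simp: subtree_def level_def)
  have inv: "k w \<in> ?V \<and> (w \<in> subtree d a \<longrightarrow> k w \<in> subtree d a)" 
    if k: "k \<in> rist d G a" and w: "w \<in> ?V" for k a w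
  proof -
    have b: "bij_betw k ?V ?V" using B[OF k] by (simp add: Bij_def)
    have V: "k w \<in> ?V" using b w by (auto simp: bij_betw_def)
    have "k w \<in> subtree d a" if "w \<in> subtree d a"
    proof (rule ccontr)
      assume n: "k w \<notin> subtree d a"
      then have "k (k w) = k w" using k V by (auto simp: rist_def)
      then have "k w = w" using b V w by (auto simp: bij_betw_def inj_on_def)
      with n that show False by simp
    qed
    with V show ?thesis by blast
  qed
  have fix_out: "k w = w" if "k \<in> rist d G a" "w \<in> ?V" "w \<notin> subtree d a" for k a w
    using that by (auto simp: rist_def)
  have "compose ?V g h = compose ?V h g"
  proof (rule extensionalityI[of _ ?V])
    fix w assume w: "w \<in> ?V"
    consider "w \<in> subtree d u" | "w \<in> subtree d v" "w \<notin> subtree d u"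
      | "w \<notin> subtree d u" "w \<notin> subtree d v" by blast
    then have "g (h w) = h (g w)"
    proof cases
      case 1
      then show ?thesis using disj fix_out[OF h] inv[OF g w] w by metis
    next
      case 2
      then show ?thesis using disj fix_out[OF g] inv[OF h w] w by metis
    next
      case 3
      then show ?thesis using fix_out[OF g w] fix_out[OF h w] by simp
    qed
    then show "compose ?V g h w = compose ?V h g w" using w by (simp add: compose_def)
  qed (auto simp: compose_def)
  then show ?thesis using B[OF g] B[OF h] by (simp add: Aut_tree_def BijGroup_def)
qed

end

theory Submission
  imports Defs "HOL-Algebra.Zassenhaus"
begin

text \<open>Give \<open>G\<close> the congruence topology and let \<open>\<X>\<close> consist of the subgroups \<open>H\<close> such that every
  normal subgroup of every finite-index subgroup of \<open>H\<close> is closed in \<open>G\<close>. This family is inductive.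
  For (III), let \<open>N\<close> be normal in a finite-index subgroup of \<open>H\<close> and let \<open>g\<close> be a limit of \<open>N\<close>. For a
  first-level vertex \<open>v\<close>, the image \<open>\<phi>\<^sub>v(N)\<close> is closed, so after multiplying \<open>g\<close> by an element of \<open>N\<close>
  its section at \<open>v\<close> is trivial; the images \<open>\<phi>\<^sub>v(N \<inter> Stab(n))\<close> are closed of finite index in \<open>\<phi>\<^sub>v(N)\<close>,
  hence open, so the new \<open>g\<close> is a limit of \<open>N \<inter> ker \<phi>\<^sub>v\<close>, and one continues with the next vertex.

  That \<open>G\<close> itself is in \<open>\<X>\<close> uses the branch structure and the congruence subgroup property. For \<open>N\<close>
  normal in \<open>F\<close> of finite index there is a level \<open>m\<close> at which every vertex is either moved by \<open>N\<close>, in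
  which case \<open>N\<close> contains the derived subgroup of its rigid stabilizer, or has its whole subtree
  fixed by \<open>N\<close>. Up to factors supported on the fixed subtrees, \<open>N \<inter> Rist(m)\<close> thus contains the
  derived subgroup of the finitely generated group \<open>Rist(m)\<close>, and finitely generated abelian groups
  are residually finite.\<close>

section \<open>Finite index and finite generation\<close>

context group
begin

text \<open>Finite index through finitely many coset representatives taken in \<open>L\<close>: all
  groups live in one ambient structure, with no change of carrier, and \<open>H\<close> need not lie
  inside \<open>L\<close>.\<close>

definition fin_idx :: "'a set \<Rightarrow> 'a set \<Rightarrow> bool" where
  "fin_idx H L \<longleftrightarrow> (\<exists>T. finite T \<and> T \<subseteq> L \<and> (\<forall>x\<in>L. \<exists>t\<in>T. x \<otimes> inv t \<in> H))"

lemma fin_idx_refl: "subgroup H G \<Longrightarrow> fin_idx H H"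
  unfolding fin_idx_def
  by (rule exI[of _ "{\<one>}"]) (auto simp: subgroup.one_closed subgroup.mem_carrier)

text \<open>Representatives multiply: \<open>x t^-1 \<in> H\<close> and
  \<open>x t^-1 s^-1 \<in> F\<close> put \<open>x\<close> into the coset of \<open>F\<close> given
  by \<open>s t\<close>.\<close>

lemma fin_idx_trans:
  assumes "subgroup H G" "subgroup L G" "subgroup F G" "F \<subseteq> H" "H \<subseteq> L"
    and FH: "fin_idx F H" and HL: "fin_idx H L"
  shows "fin_idx F L"
proof -
  obtain S where S: "finite S" "S \<subseteq> H" "\<And>x. x \<in> H \<Longrightarrow> \<exists>t\<in>S. x \<otimes> inv t \<in> F"
    using FH unfolding fin_idx_def by blast
  obtain T where T: "finite T" "T \<subseteq> L" "\<And>x. x \<in> L \<Longrightarrow> \<exists>t\<in>T. x \<otimes> inv t \<in> H"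
    using HL unfolding fin_idx_def by blast
  have LG: "L \<subseteq> carrier G" using assms(2) by (rule subgroup.subset)
  show ?thesis unfolding fin_idx_def
  proof (intro exI[of _ "(\<lambda>(s,t). s \<otimes> t) ` (S \<times> T)"] conjI ballI)
    show "finite ((\<lambda>(s, t). s \<otimes> t) ` (S \<times> T))" using S T by simp
    show "(\<lambda>(s, t). s \<otimes> t) ` (S \<times> T) \<subseteq> L"
      using S(2) T(2) \<open>H \<subseteq> L\<close> by (auto intro!: subgroup.m_closed[OF assms(2)])
  next
    fix x assume x: "x \<in> L"
    obtain t where t: "t \<in> T" "x \<otimes> inv t \<in> H" using T(3)[OF x] by blast
    obtain s where s: "s \<in> S" "x \<otimes> inv t \<otimes> inv s \<in> F" using S(3)[OF t(2)] by blast
    have "x \<in> carrier G" "t \<in> carrier G" "s \<in> carrier G"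
      using x t s S T LG assms by blast+
    then have "x \<otimes> inv (s \<otimes> t) = x \<otimes> inv t \<otimes> inv s"
      by (simp add: inv_mult_group m_assoc)
    then show "\<exists>u\<in>(\<lambda>(s, t). s \<otimes> t) ` (S \<times> T). x \<otimes> inv u \<in> F"
      using s t by force
  qed
qed

text \<open>The given representatives lie in \<open>L\<close> only, so each coset of
  \<open>F\<close> that meets \<open>H\<close> receives a new representative \<open>r t\<close>
  inside \<open>H\<close>.\<close>

lemma fin_idx_Int:
  assumes "subgroup F G" "subgroup H G" "H \<subseteq> L" "L \<subseteq> carrier G" and FL: "fin_idx F L"
  shows "fin_idx (F \<inter> H) H"
proof -
  obtain T where T: "finite T" "T \<subseteq> L" "\<And>x. x \<in> L \<Longrightarrow> \<exists>t\<in>T. x \<otimes> inv t \<in> F"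
    using FL unfolding fin_idx_def by blast
  define T0 where "T0 = {t\<in>T. \<exists>h\<in>H. h \<otimes> inv t \<in> F}"
  have "\<forall>t\<in>T0. \<exists>h. h \<in> H \<and> h \<otimes> inv t \<in> F" by (auto simp: T0_def)
  then obtain r where r: "\<And>t. t \<in> T0 \<Longrightarrow> r t \<in> H \<and> r t \<otimes> inv t \<in> F"
    by metis
  show ?thesis unfolding fin_idx_def
  proof (intro exI[of _ "r ` T0"] conjI ballI)
    show "finite (r ` T0)" using T by (simp add: T0_def)
    show "r ` T0 \<subseteq> H" using r by auto
  next
    fix x assume x: "x \<in> H"
    obtain t where t: "t \<in> T" "x \<otimes> inv t \<in> F" using T(3) x assms by blast
    then have t0: "t \<in> T0" using x by (auto simp: T0_def)
    have c: "x \<in> carrier G" "t \<in> carrier G" "r t \<in> carrier G"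
      using x t T assms r[OF t0] by blast+
    have "x \<otimes> inv (r t) = (x \<otimes> inv t) \<otimes> inv (r t \<otimes> inv t)"
      using c by (simp add: inv_mult_group m_assoc) (simp add: m_assoc[symmetric])
    also have "\<dots> \<in> F"
      using t r[OF t0] assms by (meson subgroup.m_closed subgroup.m_inv_closed)
    finally have "x \<otimes> inv (r t) \<in> F" .
    moreover have "x \<otimes> inv (r t) \<in> H"
      using x r[OF t0] assms by (meson subgroup.m_closed subgroup.m_inv_closed)
    ultimately show "\<exists>u\<in>r ` T0. x \<otimes> inv u \<in> F \<inter> H" using t0 by blast
  qed
qed

text \<open>Links \<open>fin_idx\<close> to the count of cosets:
  \<open>x \<otimes> inv t \<in> H\<close> holds exactly when \<open>x\<close> and \<open>t\<close>
  lie in the same right coset of \<open>H\<close>.\<close>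

lemma finite_index_iff_fin_idx:
  assumes H: "subgroup H G" and L: "subgroup L G" and HL: "H \<subseteq> L"
  shows "finite_index (G\<lparr>carrier := L\<rparr>) H \<longleftrightarrow> fin_idx H L"
proof -
  have LG: "L \<subseteq> carrier G" using L by (rule subgroup.subset)
  have rc: "rcosets\<^bsub>G\<lparr>carrier := L\<rparr>\<^esub> H = (\<lambda>a. H #> a) ` L"
    by (auto simp: RCOSETS_def r_coset_def)
  have mem: "x \<otimes> inv t \<in> H \<longleftrightarrow> H #> x = H #> t" if "x \<in> L" "t \<in> L" for x t
  proof -
    have c: "x \<in> carrier G" "t \<in> carrier G" using that LG by auto
    have "x \<otimes> inv t \<in> H \<longleftrightarrow> x \<in> H #> t"
      using subgroup.rcos_module[OF H is_group c(2,1)] by simp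
    then show ?thesis using repr_independence[OF _ c(2) H] rcos_self[OF c(1) H] by metis
  qed
  show ?thesis
  proof
    assume "finite_index (G\<lparr>carrier := L\<rparr>) H"
    then have "finite ((\<lambda>a. H #> a) ` L)" by (simp add: finite_index_def rc)
    then obtain T where T: "T \<subseteq> L" "finite T" "(\<lambda>a. H #> a) ` L = (\<lambda>a. H #> a) ` T"
      using finite_subset_image[OF _ subset_refl] by metis
    have "\<exists>t\<in>T. x \<otimes> inv t \<in> H" if "x \<in> L" for x
    proof -
      have "H #> x \<in> (\<lambda>a. H #> a) ` T" using that T(3) by blast
      then obtain t where "t \<in> T" "H #> x = H #> t" by blast
      then show ?thesis using mem[OF that, of t] T(1) by blast
    qed
    then show "fin_idx H L" unfolding fin_idx_def using T by blast
  next
    assume "fin_idx H L"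
    then obtain T where T: "finite T" "T \<subseteq> L" "\<And>x. x \<in> L \<Longrightarrow> \<exists>t\<in>T. x \<otimes> inv t \<in> H"
      unfolding fin_idx_def by blast
    have "(\<lambda>a. H #> a) ` L \<subseteq> (\<lambda>a. H #> a) ` T"
    proof (rule image_subsetI)
      fix x assume x: "x \<in> L"
      obtain t where t: "t \<in> T" "x \<otimes> inv t \<in> H" using T(3)[OF x] by blast
      then have "H #> x = H #> t" using mem[OF x, of t] T(2) by blast
      then show "H #> x \<in> (\<lambda>a. H #> a) ` T" using t(1) by blast
    qed
    then show "finite_index (G\<lparr>carrier := L\<rparr>) H"
      unfolding finite_index_def rc using T(1) by (meson finite_imageI finite_subset)
  qed
qed

text \<open>Schreier's argument: a word is rewritten letter by letter as an element of
  \<open>W\<close> times a representative.\<close>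

lemma fin_idx_generate:
  assumes S: "finite S" "S \<subseteq> carrier G" "carrier G = generate G S"
    and R: "subgroup R G" and RG: "fin_idx R (carrier G)"
  shows "\<exists>U. finite U \<and> U \<subseteq> R \<and> R = generate G U"
proof -
  obtain T0 where T0: "finite T0" "T0 \<subseteq> carrier G" "\<And>x. x \<in> carrier G \<Longrightarrow> \<exists>t\<in>T0. x \<otimes> inv t \<in> R"
    using RG unfolding fin_idx_def by blast
  define T where "T = insert \<one> T0"
  define S' where "S' = S \<union> (\<lambda>s. inv s) ` S"
  \<comment> \<open>Schreier generators. Representatives need not be unique and
    \<open>\<one>\<close> is adjoined to them, so those lying in \<open>R\<close> are added to
    absorb the representative left at the end of a word.\<close>
  define U where "U = R \<inter> ((\<lambda>(t,s,u). t \<otimes> s \<otimes> inv u) ` (T \<times> S' \<times> T) \<union> T)"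
  define W where "W = generate G U"
  have T: "finite T" "T \<subseteq> carrier G" "\<one> \<in> T" using T0 by (auto simp: T_def)
  have S': "finite S'" "S' \<subseteq> carrier G" using S(1,2) by (auto simp: S'_def)
  have U: "finite U" "U \<subseteq> R" using T S' by (auto simp: U_def)
  have UG: "U \<subseteq> carrier G" using U R subgroup.subset by blast
  have W: "subgroup W G" unfolding W_def using UG by (rule generate_is_subgroup)
  have WR: "W \<subseteq> R" unfolding W_def using U(2) R by (rule generate_subgroup_incl)
  \<comment> \<open>The set \<open>W T\<close> is stable under right multiplication by
    letters.\<close>
  have step: "\<exists>w\<in>W. \<exists>t\<in>T. x \<otimes> s = w \<otimes> t"
    if x: "\<exists>w\<in>W. \<exists>t\<in>T. x = w \<otimes> t" and s: "s \<in> S'" for x s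
  proof -
    obtain w t where wt: "w \<in> W" "t \<in> T" "x = w \<otimes> t" using x by blast
    have c: "w \<in> carrier G" "t \<in> carrier G" "s \<in> carrier G" 
      using wt W T S' s subgroup.subset by blast+
    then obtain u where u: "u \<in> T" "t \<otimes> s \<otimes> inv u \<in> R" using T0(3)[of "t \<otimes> s"] 
      by (auto simp: T_def)
    have uc: "u \<in> carrier G" using u T by blast
    have "t \<otimes> s \<otimes> inv u \<in> U" unfolding U_def using wt u s by force
    then have "t \<otimes> s \<otimes> inv u \<in> W" unfolding W_def by (rule generate.incl)
    then have "w \<otimes> (t \<otimes> s \<otimes> inv u) \<in> W" using W wt by (meson subgroup.m_closed)
    moreover have "x \<otimes> s = w \<otimes> (t \<otimes> s \<otimes> inv u) \<otimes> u"
      using c uc wt by (simp add: m_assoc)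
    ultimately show ?thesis using u by blast
  qed
  have prod: "\<exists>w\<in>W. \<exists>t\<in>T. x \<otimes> y = w \<otimes> t"
    if "y \<in> generate G S" "x \<in> carrier G" "\<exists>w\<in>W. \<exists>t\<in>T. x = w \<otimes> t" for x y
    using that
  proof (induction arbitrary: x rule: generate.induct)
    case one then show ?case by simp
  next
    case (incl h) then show ?case using step[of x h] by (auto simp: S'_def)
  next
    case (inv h) then show ?case using step[of x "inv h"] by (auto simp: S'_def)
  next
    case (eng h1 h2)
    have c: "h1 \<in> carrier G" "h2 \<in> carrier G" using eng.hyps S by auto
    have "x \<otimes> h1 \<in> carrier G" using c eng by simp
    from eng.IH(2)[OF this eng.IH(1)[OF eng.prems]] show ?case
      using c eng.prems by (simp add: m_assoc)
  qed
  have "R \<subseteq> W"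
  proof
    fix r assume r: "r \<in> R"
    then have rc: "r \<in> carrier G" using R subgroup.subset by blast
    have "\<one> = \<one> \<otimes> \<one>" by simp
    then have "\<exists>w\<in>W. \<exists>t\<in>T. \<one> = w \<otimes> t" using T(3) W subgroup.one_closed by blast
    then obtain w t where wt: "w \<in> W" "t \<in> T" "r = w \<otimes> t"
      using prod[of r \<one>] rc S(3) by auto
    have c: "w \<in> carrier G" "t \<in> carrier G" using wt T W subgroup.subset by blast+
    have "t = inv w \<otimes> r" using wt c by (simp add: m_assoc[symmetric])
    also have "\<dots> \<in> R" using wt WR r R by (meson subgroup.m_closed subgroup.m_inv_closed subsetD)
    finally have "t \<in> U" using wt by (simp add: U_def)
    then have "t \<in> W" unfolding W_def by (rule generate.incl)
    then show "r \<in> W" using wt W by (simp add: subgroup.m_closed)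
  qed
  then show ?thesis using U WR unfolding W_def by blast
qed

text \<open>A subgroup \<open>M\<close> maximal among those avoiding \<open>g\<close> has torsion quotient: for \<open>s\<close> of infinite
  order modulo \<open>M\<close> one would have \<open>g \<in> M s\<^sup>k\<close> and \<open>g \<in> M s\<^bsup>2kl\<^esup>\<close> for some \<open>k\<close>, \<open>l\<close>.\<close>

lemma fin_gen_abelian_quotient_separates:
  assumes S: "finite S" "S \<subseteq> carrier G" "carrier G = generate G S"
    and N: "subgroup N G"
    and comm: "\<And>x y. x \<in> carrier G \<Longrightarrow> y \<in> carrier G \<Longrightarrow> x \<otimes> y \<otimes> inv x \<otimes> inv y \<in> N"
    and g: "g \<in> carrier G" "g \<notin> N"
  shows "\<exists>M. subgroup M G \<and> N \<subseteq> M \<and> g \<notin> M \<and> fin_idx M (carrier G)"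
proof -
  define \<A> where "\<A> = {M. subgroup M G \<and> N \<subseteq> M \<and> g \<notin> M}"
  have "\<exists>M\<in>\<A>. \<forall>X\<in>\<A>. M \<subseteq> X \<longrightarrow> X = M"
  proof (rule subset_Zorn_nonempty)
    show "\<A> \<noteq> {}" using N g by (auto simp: \<A>_def)
  next
    fix C assume C: "C \<noteq> {}" "subset.chain \<A> C"
    then have CA: "C \<subseteq> \<A>" and tot: "\<And>X Y. X \<in> C \<Longrightarrow> Y \<in> C \<Longrightarrow> X \<subseteq> Y \<or> Y \<subseteq> X"
      by (auto simp: subset.chain_def)
    have sg: "subgroup X G" if "X \<in> C" for X using that CA by (auto simp: \<A>_def)
    have "subgroup (\<Union>C) G"
    proof (rule subgroupI)
      show "\<Union>C \<subseteq> carrier G" using sg subgroup.subset by blast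
      show "\<Union>C \<noteq> {}" using C sg subgroup.one_closed by blast
      show "inv a \<in> \<Union>C" if "a \<in> \<Union>C" for a
        using that sg by (meson UnionE UnionI subgroup.m_inv_closed)
      show "a \<otimes> b \<in> \<Union>C" if ab: "a \<in> \<Union>C" "b \<in> \<Union>C" for a b
      proof -
        obtain X Y where "X \<in> C" "a \<in> X" "Y \<in> C" "b \<in> Y" using ab by blast
        with tot[of X Y] obtain Z where "Z \<in> C" "a \<in> Z" "b \<in> Z" by blast
        then show ?thesis using sg by (meson UnionI subgroup.m_closed)
      qed
    qed
    then show "\<Union>C \<in> \<A>" using C CA by (auto simp: \<A>_def)
  qed
  then obtain M where "M \<in> \<A>" and maxM: "\<And>X. X \<in> \<A> \<Longrightarrow> M \<subseteq> X \<Longrightarrow> X = M" by blast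
  then have M: "subgroup M G" "N \<subseteq> M" "g \<notin> M" by (auto simp: \<A>_def)
  \<comment> \<open>A subgroup containing all commutators is normal: \<open>x h x^-1\<close> is the
    commutator of \<open>x\<close> and \<open>h\<close>, times \<open>h\<close>.\<close>
  have nrm: "L \<lhd> G" if L: "subgroup L G" "N \<subseteq> L" for L
  proof -
    have "x \<otimes> h \<otimes> inv x \<in> L" if x: "x \<in> carrier G" and h: "h \<in> L" for x h
    proof -
      have hc: "h \<in> carrier G" using h L subgroup.subset by blast
      have "x \<otimes> h \<otimes> inv x \<otimes> inv h \<otimes> h \<in> L"
        using comm[OF x hc] L h by (meson subgroup.m_closed subsetD)
      then show ?thesis using x hc by (simp add: m_assoc)
    qed
    then show ?thesis using L by (simp add: normal_inv_iff)
  qed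
  \<comment> \<open>For \<open>s \<notin> M\<close> the group generated by \<open>M\<close> and
    \<open>s\<close> is strictly larger than \<open>M\<close>, so by maximality it contains
    \<open>g\<close>.\<close>
  have gpow: "\<exists>m\<in>M. \<exists>i::int. g = m \<otimes> (s [^] i)" if s: "s \<in> carrier G" "s \<notin> M" for s
  proof -
    let ?K = "M <#> generate G {s}"
    have sub: "subgroup (generate G {s}) G" using s by (intro generate_is_subgroup) simp
    have K: "subgroup ?K G" using nrm[OF M(1,2)] sub by (rule mult_norm_subgroup)
    have "M \<subseteq> ?K"
    proof
      fix m assume m: "m \<in> M"
      then have "m = m \<otimes> \<one>" using subgroup.mem_carrier[OF M(1)] by simp
      then show "m \<in> ?K" using m sub subgroup.one_closed unfolding set_mult_def by blast
    qed
    moreover have "s \<in> ?K"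
    proof -
      have "s = \<one> \<otimes> s" using s by simp
      then show ?thesis using M(1) subgroup.one_closed generate.incl[of s "{s}" G]
        unfolding set_mult_def by blast
    qed
    ultimately have MK: "M \<subseteq> ?K" "?K \<noteq> M" using s(2) by auto
    have "g \<in> ?K"
    proof (rule ccontr)
      assume "g \<notin> ?K"
      then have "?K \<in> \<A>" using K MK(1) M(2) by (simp add: \<A>_def)
      then show False using maxM MK by simp
    qed
    then show ?thesis unfolding set_mult_def generate_pow[OF s(1)] by clarsimp metis
  qed
  have tors: "\<exists>n::nat. n > 0 \<and> s [^] n \<in> M" if s: "s \<in> carrier G" for s
  proof -
    have "\<exists>k::int. k \<noteq> 0 \<and> s [^] k \<in> M"
    proof (cases "s \<in> M")
      case True
      then have "s [^] (1::int) \<in> M" using int_pow_1[OF s] by simp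
      moreover have "(1::int) \<noteq> 0" by (rule one_neq_zero)
      ultimately show ?thesis by (rule_tac x = 1 in exI) (rule conjI)
    next
      case False
      obtain m i where m: "m \<in> M" "g = m \<otimes> (s [^] (i::int))" using gpow[OF s False] by (elim bexE exE) (rule that)
      have i0: "i \<noteq> 0"
      proof
        assume "i = 0"
        then have "g = m" using m subgroup.mem_carrier[OF M(1) m(1)] by simp
        then show False using m M by simp
      qed
      show ?thesis
      proof (cases "s [^] (2 * i) \<in> M")
        case True
        moreover have "2 * i \<noteq> 0" using i0 by simp
        ultimately show ?thesis by (rule_tac x = "2 * i" in exI) (rule conjI)
      next
        case False
        obtain m' j where m': "m' \<in> M" "g = m' \<otimes> ((s [^] (2 * i)) [^] (j::int))"
          using gpow[OF int_pow_closed[OF s] False] by (elim bexE exE) (rule that)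
        have c: "m \<in> carrier G" "m' \<in> carrier G"
          using subgroup.mem_carrier[OF M(1)] m(1) m'(1) by blast+
        have g': "g = m' \<otimes> s [^] (2 * i * j)" using m'(2) s by (simp add: int_pow_pow)
        have "s [^] (i - 2 * i * j) = s [^] i \<otimes> inv (s [^] (2 * i * j))"
          using s by (simp add: int_pow_diff)
        also have "s [^] i = inv m \<otimes> g" using m(2) c s by (simp add: m_assoc[symmetric])
        also have "inv m \<otimes> g \<otimes> inv (s [^] (2 * i * j)) = inv m \<otimes> m'"
          using c s by (simp add: g' m_assoc)
        also have "\<dots> \<in> M" using m(1) m'(1) M(1) by (simp add: subgroup.m_closed subgroup.m_inv_closed)
        finally have "s [^] (i - 2 * i * j) \<in> M" .
        \<comment> \<open>The exponent is \<open>i (1 - 2 j)\<close> with an odd second factor; this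
          is what the doubled exponent is for.\<close>
        moreover have "i - 2 * i * j \<noteq> 0"
        proof
          assume "i - 2 * i * j = 0"
          then have "i * (1 - 2 * j) = 0" by (simp add: right_diff_distrib)
          then have "1 - 2 * j = 0" using i0 by (metis mult_eq_0_iff)
          then show False by presburger
        qed
        ultimately show ?thesis by (rule_tac x = "i - 2 * i * j" in exI) (rule conjI)
      qed
    qed
    then obtain k :: int where k: "k \<noteq> 0" "s [^] k \<in> M" by (elim exE conjE) (rule that)
    have "s [^] (nat \<bar>k\<bar>) = s [^] \<bar>k\<bar>" by (simp add: int_pow_int[symmetric])
    also have "\<dots> \<in> M"
    proof (cases "k > 0")
      case True then show ?thesis using k by simp
    next
      case False
      then have "s [^] \<bar>k\<bar> = s [^] (- k)" by simp
      also have "\<dots> = inv (s [^] k)" using s by (simp add: int_pow_neg)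
      finally show ?thesis using k M by (simp add: subgroup.m_inv_closed)
    qed
    finally show ?thesis using k by (rule_tac x = "nat \<bar>k\<bar>" in exI) simp
  qed
  \<comment> \<open>Adjoining elements one by one, each of finite order modulo \<open>M\<close>,
    keeps the index of \<open>M\<close> finite; applied to the generators \<open>S\<close>, this
    reaches the whole group.\<close>
  have "\<exists>L. subgroup L G \<and> M \<subseteq> L \<and> S' \<subseteq> L \<and> fin_idx M L" if "finite S'" "S' \<subseteq> carrier G" for S'
    using that
  proof (induction S')
    case empty then show ?case using M fin_idx_refl by blast
  next
    case (insert s S')
    then obtain L where L: "subgroup L G" "M \<subseteq> L" "S' \<subseteq> L" "fin_idx M L" and s: "s \<in> carrier G"
      by auto
    obtain n :: nat where n: "n > 0" "s [^] n \<in> M"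
      using tors[OF s] by (elim exE conjE) (rule that)
    let ?L = "L <#> generate G {s}"
    have sub: "subgroup (generate G {s}) G" using s by (intro generate_is_subgroup) simp
    have "L \<lhd> G" using L M using M(2) by (intro nrm) auto
    then have L': "subgroup ?L G" using sub by (rule mult_norm_subgroup)
    have LL: "L \<subseteq> ?L"
    proof
      fix m assume m: "m \<in> L"
      then have "m = m \<otimes> \<one>" using subgroup.mem_carrier[OF L(1)] by simp
      then show "m \<in> ?L" using m sub subgroup.one_closed unfolding set_mult_def by blast
    qed
    have sL: "s \<in> ?L"
    proof -
      have "s = \<one> \<otimes> s" using s by simp
      then show ?thesis using L(1) subgroup.one_closed generate.incl[of s "{s}" G]
        unfolding set_mult_def by blast
    qed
    \<comment> \<open>Division with remainder by \<open>n\<close> reduces every power of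
      \<open>s\<close> modulo \<open>L\<close> to one of the first \<open>n\<close>.\<close>
    have "fin_idx L ?L" unfolding fin_idx_def
    proof (intro exI[of _ "(\<lambda>i::nat. s [^] i) ` {..<n}"] conjI ballI)
      show "(\<lambda>i::nat. s [^] i) ` {..<n} \<subseteq> ?L"
      proof (rule image_subsetI)
        fix i :: nat
        have "s [^] (int i) \<in> ?L" using L' sL by (rule subgroup_int_pow_closed)
        then show "s [^] i \<in> ?L" by (simp add: int_pow_int)
      qed
    next
      fix x assume "x \<in> ?L"
      then obtain l k where l: "l \<in> L" "x = l \<otimes> (s [^] (k::int))"
        unfolding set_mult_def generate_pow[OF s] by clarsimp
      have lc: "l \<in> carrier G" using subgroup.mem_carrier[OF L(1) l(1)] .
      define r q where "r = nat (k mod int n)" and "q = k div int n"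
      have r: "r < n" using n(1) by (simp add: r_def nat_less_iff)
      have k: "k = int n * q + int r" using n(1) by (simp add: r_def q_def)
      have "s [^] k = (s [^] n) [^] q \<otimes> s [^] r"
        using int_pow_mult[OF s, of "int n * q" "int r"] int_pow_pow[OF s, of "int n" q]
        by (simp add: k int_pow_int)
      then have "x = l \<otimes> (s [^] n) [^] q \<otimes> s [^] r"
        using l(2) lc s by (simp add: m_assoc)
      then have "x \<otimes> inv (s [^] r) = l \<otimes> (s [^] n) [^] q"
        using lc s by (simp add: m_assoc)
      moreover have "(s [^] n) [^] q \<in> L"
        using subgroup_int_pow_closed[OF L(1)] n(2) L(2) by blast
      ultimately have "x \<otimes> inv (s [^] r) \<in> L" using subgroup.m_closed[OF L(1) l(1)] by simp
      then show "\<exists>t\<in>(\<lambda>i::nat. s [^] i) ` {..<n}. x \<otimes> inv t \<in> L" using r by blast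
    qed simp
    then have "fin_idx M ?L" using fin_idx_trans[OF L(1) L' M(1) L(2) LL] L(4) by blast
    moreover have "M \<subseteq> ?L" "insert s S' \<subseteq> ?L" using L(2,3) LL sL by auto
    ultimately show ?case using L' by blast
  qed
  then obtain L where L: "subgroup L G" "M \<subseteq> L" "S \<subseteq> L" "fin_idx M L" using S(1,2) by blast
  have "carrier G \<subseteq> L" unfolding S(3) using L by (intro generate_subgroup_incl) auto
  then have "L = carrier G" using L subgroup.subset by blast
  then show ?thesis using M L by blast
qed

end

section \<open>Groups with a residual filtration\<close>

text \<open>The subgroups \<open>U n\<close> form a neighbourhood base of \<open>\<one>\<close> for
  a Hausdorff group topology; the level stabilizers are the intended instance.\<close>

locale residual_filtration = group G for G (structure) +
  fixes U :: "nat \<Rightarrow> 'a set"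
  assumes U_normal: "U n \<lhd> G"
    and U_antimono: "m \<le> n \<Longrightarrow> U n \<subseteq> U m"
    and U_fin_idx: "fin_idx (U n) (carrier G)"
    and U_separated: "(\<Inter>n. U n) = {\<one>}"
begin

text \<open>The closure of \<open>N\<close> in this topology, that is, the intersection of the sets
  \<open>N U n\<close>.\<close>

definition cl :: "'a set \<Rightarrow> 'a set" where
  "cl N = {g \<in> carrier G. \<forall>n. \<exists>x\<in>N. inv x \<otimes> g \<in> U n}"

text \<open>Closedness of all normal subgroups \<open>N\<close> of all finite-index subgroups \<open>F\<close> of \<open>H\<close>, and not just
  of \<open>H\<close>, is what survives the passage to subdirect products.\<close>

definition hereditarily_closed :: "'a set \<Rightarrow> bool" where
  "hereditarily_closed H \<longleftrightarrow>
     (\<forall>F N. subgroup F G \<and> F \<subseteq> H \<and> fin_idx F H \<and> subgroup N G \<and> N \<subseteq> F \<and>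
        (\<forall>f\<in>F. \<forall>x\<in>N. f \<otimes> x \<otimes> inv f \<in> N) \<longrightarrow> cl N \<subseteq> N)"

section \<open>Open and closed subgroups\<close>

lemma U_subgroup: "subgroup (U n) G"
  using U_normal by (rule normal_imp_subgroup)

lemma cl_trivial: "cl {\<one>} \<subseteq> {\<one>}"
  using U_separated by (auto simp: cl_def)

text \<open>A limit lies in \<open>x U k\<close> for some \<open>x \<in> V\<close>, and this coset
  is contained in \<open>V\<close>.\<close>

lemma cl_of_open:
  assumes V: "subgroup V G" "U k \<subseteq> V"
  shows "cl V \<subseteq> V"
proof
  fix g assume g: "g \<in> cl V"
  then obtain x where x: "x \<in> V" "inv x \<otimes> g \<in> U k" by (auto simp: cl_def)
  have c: "g \<in> carrier G" "x \<in> carrier G"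
    using g subgroup.mem_carrier[OF V(1) x(1)] by (auto simp: cl_def)
  have "x \<otimes> (inv x \<otimes> g) \<in> V" using x V by (meson subgroup.m_closed subsetD)
  then show "g \<in> V" using c by (simp add: m_assoc[symmetric])
qed

text \<open>\<open>N\<close> is a finite union of translates \<open>N0 t\<close> of a closed
  set.\<close>

lemma cl_of_fin_idx:
  assumes N: "subgroup N G" "subgroup N0 G" "N0 \<subseteq> N" and fi: "fin_idx N0 N"
    and cl: "cl N0 \<subseteq> N0"
  shows "cl N \<subseteq> N"
proof
  fix g assume g: "g \<in> cl N"
  then have gc: "g \<in> carrier G" by (simp add: cl_def)
  obtain T where T: "finite T" "T \<subseteq> N" "\<And>x. x \<in> N \<Longrightarrow> \<exists>t\<in>T. x \<otimes> inv t \<in> N0"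
    using fi unfolding fin_idx_def by blast
  have Tc: "T \<subseteq> carrier G" using T(2) subgroup.subset[OF N(1)] by blast
  have "\<exists>t\<in>T. g \<otimes> inv t \<in> cl N0"
  proof (rule ccontr)
    assume "\<not> (\<exists>t\<in>T. g \<otimes> inv t \<in> cl N0)"
    then have "\<forall>t\<in>T. \<exists>n. \<forall>y\<in>N0. inv y \<otimes> (g \<otimes> inv t) \<notin> U n"
      using gc Tc by (auto simp: cl_def)
    then obtain f where f: "\<And>t y. t \<in> T \<Longrightarrow> y \<in> N0 \<Longrightarrow> inv y \<otimes> (g \<otimes> inv t) \<notin> U (f t)"
      by metis
    \<comment> \<open>Since \<open>T\<close> is finite, one level \<open>m\<close> separates
      \<open>g\<close> from every translate at once.\<close>
    obtain m where m: "\<And>t. t \<in> T \<Longrightarrow> f t \<le> m" using Max_ge[of "f ` T"] T(1) by blast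
    obtain x where x: "x \<in> N" "inv x \<otimes> g \<in> U m" using g by (auto simp: cl_def)
    obtain t where t: "t \<in> T" "x \<otimes> inv t \<in> N0" using T(3)[OF x(1)] by blast
    have c: "x \<in> carrier G" "t \<in> carrier G"
      using subgroup.mem_carrier[OF N(1) x(1)] t(1) Tc by auto
    have "t \<otimes> (inv x \<otimes> g) \<otimes> inv t \<in> U m"
      using normal.inv_op_closed2[OF U_normal c(2) x(2)] .
    moreover have "t \<otimes> (inv x \<otimes> g) \<otimes> inv t = inv (x \<otimes> inv t) \<otimes> (g \<otimes> inv t)"
      using c gc by (simp add: inv_mult_group m_assoc)
    ultimately have "inv (x \<otimes> inv t) \<otimes> (g \<otimes> inv t) \<in> U (f t)"
      using U_antimono[OF m[OF t(1)]] by auto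
    with f[OF t] show False by blast
  qed
  then obtain t where t: "t \<in> T" "g \<otimes> inv t \<in> N" using cl N(3) by blast
  have tN: "t \<in> N" and tc: "t \<in> carrier G" using t(1) T(2) Tc by auto
  have "g \<otimes> inv t \<otimes> t \<in> N" using subgroup.m_closed[OF N(1) t(2) tN] .
  then show "g \<in> N" using gc tc by (simp add: m_assoc)
qed

text \<open>The cosets of \<open>V\<close> in \<open>M\<close> other than \<open>V\<close> itself
  are finitely many closed sets missing \<open>\<one>\<close>, so some \<open>U k\<close> avoids
  them all.\<close>

lemma closed_fin_idx_open:
  assumes V: "subgroup V G" "subgroup M G" "V \<subseteq> M" and fi: "fin_idx V M" and cl: "cl V \<subseteq> V"
  shows "\<exists>k. M \<inter> U k \<subseteq> V"
proof -
  obtain T where T: "finite T" "T \<subseteq> M" "\<And>x. x \<in> M \<Longrightarrow> \<exists>t\<in>T. x \<otimes> inv t \<in> V"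
    using fi unfolding fin_idx_def by blast
  have Tc: "T \<subseteq> carrier G" using T(2) subgroup.subset[OF V(2)] by blast
  have "\<forall>t\<in>T. \<exists>n. t \<in> V \<or> (\<forall>y\<in>V. inv y \<otimes> t \<notin> U n)"
    using cl Tc by (fastforce simp: cl_def)
  then obtain f where f: "\<And>t y. t \<in> T \<Longrightarrow> t \<notin> V \<Longrightarrow> y \<in> V \<Longrightarrow> inv y \<otimes> t \<notin> U (f t)"
    by metis
  obtain m where m: "\<And>t. t \<in> T \<Longrightarrow> f t \<le> m" using Max_ge[of "f ` T"] T(1) by blast
  have "M \<inter> U m \<subseteq> V"
  proof
    fix x assume x: "x \<in> M \<inter> U m"
    then obtain t where t: "t \<in> T" "x \<otimes> inv t \<in> V" using T(3) by blast
    have c: "x \<in> carrier G" "t \<in> carrier G"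
      using subgroup.mem_carrier[OF V(2)] x t(1) Tc by auto
    have xe: "x \<otimes> inv t \<otimes> t = x" using c by (simp add: m_assoc)
    \<comment> \<open>With \<open>y = (x t^-1)^-1 \<in> V\<close> the quotient \<open>y^-1 t\<close>
      is just \<open>x\<close>, so \<open>y\<close> approximates \<open>t\<close> closely enough to
      force \<open>t \<in> V\<close>.\<close>
    have "inv (inv (x \<otimes> inv t)) \<otimes> t \<in> U (f t)"
      using U_antimono[OF m[OF t(1)]] x c xe by auto
    then have "t \<in> V" using f[OF t(1) _ subgroup.m_inv_closed[OF V(1) t(2)]] by blast
    from subgroup.m_closed[OF V(1) t(2) this] show "x \<in> V" using xe by simp
  qed
  then show ?thesis by blast
qed

section \<open>Permanence properties of hereditary closedness\<close>

lemma hereditarily_closed_imp_closed: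
  assumes "subgroup H G" "hereditarily_closed H"
  shows "cl H \<subseteq> H"
proof -
  have "\<forall>f\<in>H. \<forall>x\<in>H. f \<otimes> x \<otimes> inv f \<in> H"
    using assms(1) by (simp add: subgroup.m_closed subgroup.m_inv_closed)
  then show ?thesis
    using assms fin_idx_refl[OF assms(1)] unfolding hereditarily_closed_def by blast
qed

lemma hereditarily_closed_finite_index_subgroup:
  assumes "subgroup H G" "subgroup L G" "H \<subseteq> L" "fin_idx H L" "hereditarily_closed L"
  shows "hereditarily_closed H"
  unfolding hereditarily_closed_def
proof (intro allI impI, elim conjE)
  fix F N
  assume F: "subgroup F G" "F \<subseteq> H" "fin_idx F H" and N: "subgroup N G" "N \<subseteq> F"
    "\<forall>f\<in>F. \<forall>x\<in>N. f \<otimes> x \<otimes> inv f \<in> N"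
  have "fin_idx F L" using fin_idx_trans[OF assms(1,2) F(1,2) assms(3) F(3) assms(4)] .
  moreover have "F \<subseteq> L" using F(2) assms(3) by blast
  ultimately show "cl N \<subseteq> N" using assms(5) F(1) N unfolding hereditarily_closed_def by blast
qed

text \<open>Intersecting \<open>F\<close> and \<open>N\<close> with \<open>H\<close> yields a closed
  subgroup of finite index in \<open>N\<close>, which makes \<open>N\<close> closed.\<close>

lemma hereditarily_closed_finite_index_supergroup:
  assumes "subgroup H G" "subgroup L G" "H \<subseteq> L" "fin_idx H L" "hereditarily_closed H"
  shows "hereditarily_closed L"
  unfolding hereditarily_closed_def
proof (intro allI impI, elim conjE)
  fix F N
  assume F: "subgroup F G" "F \<subseteq> L" "fin_idx F L" and N: "subgroup N G" "N \<subseteq> F"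
    "\<forall>f\<in>F. \<forall>x\<in>N. f \<otimes> x \<otimes> inv f \<in> N"
  have Lc: "L \<subseteq> carrier G" using subgroup.subset[OF assms(2)] .
  have FH: "subgroup (F \<inter> H) G" "fin_idx (F \<inter> H) H"
    using subgroups_Inter_pair[OF F(1) assms(1)] fin_idx_Int[OF F(1) assms(1,3) Lc F(3)] .
  have NH: "subgroup (H \<inter> N) G" using subgroups_Inter_pair[OF assms(1) N(1)] .
  have "\<forall>f\<in>F \<inter> H. \<forall>x\<in>H \<inter> N. f \<otimes> x \<otimes> inv f \<in> H \<inter> N"
    using N(3) assms(1) by (simp add: subgroup.m_closed subgroup.m_inv_closed)
  moreover have "H \<inter> N \<subseteq> F \<inter> H" using N(2) by blast
  ultimately have "cl (H \<inter> N) \<subseteq> H \<inter> N"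
    using assms(5) FH NH unfolding hereditarily_closed_def by blast
  moreover have "fin_idx (H \<inter> N) N"
    using fin_idx_Int[OF assms(1) N(1) _ Lc assms(4)] N(2) F(2) by blast
  ultimately show "cl N \<subseteq> N" using cl_of_fin_idx[OF N(1) NH] by blast
qed

end

lemma (in group) fin_idx_image:
  assumes "fin_idx A B" "subgroup B G" "A \<subseteq> B"
    and h: "\<And>x y. x \<in> B \<Longrightarrow> y \<in> B \<Longrightarrow> h (x \<otimes> inv y) = h x \<otimes> inv (h y)"
  shows "fin_idx (h ` A) (h ` B)"
proof -
  obtain T where T: "finite T" "T \<subseteq> B" "\<And>x. x \<in> B \<Longrightarrow> \<exists>t\<in>T. x \<otimes> inv t \<in> A"
    using assms(1) unfolding fin_idx_def by blast
  show ?thesis unfolding fin_idx_def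
  proof (intro exI[of _ "h ` T"] conjI ballI)
    fix y assume "y \<in> h ` B"
    then obtain x where x: "x \<in> B" "y = h x" by blast
    obtain t where t: "t \<in> T" "x \<otimes> inv t \<in> A" using T(3)[OF x(1)] by blast
    have "y \<otimes> inv (h t) = h (x \<otimes> inv t)" using h[OF x(1), of t] t(1) T(2) x(2) by auto
    then show "\<exists>t\<in>h ` T. y \<otimes> inv t \<in> h ` A" using t by auto
  qed (use T in auto)
qed

context residual_filtration
begin

text \<open>The coordinates are treated one at a time: the part of \<open>N\<close> that is trivial in the treated
  coordinates is again normal in the same \<open>F\<close>.\<close>

lemma hereditarily_closed_subdirect:
  assumes H: "subgroup H G" "H \<subseteq> S" and S: "subgroup S G" "U 1 \<subseteq> S" and J: "finite J"
    and hom: "\<And>v. v \<in> J \<Longrightarrow> \<pi> v \<in> hom (G\<lparr>carrier := S\<rparr>) G"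
    and cont: "\<And>v n x. v \<in> J \<Longrightarrow> x \<in> S \<Longrightarrow> x \<in> U (Suc n) \<Longrightarrow> \<pi> v x \<in> U n"
    and faithful: "\<And>x. x \<in> S \<Longrightarrow> (\<And>v. v \<in> J \<Longrightarrow> \<pi> v x = \<one>) \<Longrightarrow> x = \<one>"
    and hc: "\<And>v. v \<in> J \<Longrightarrow> hereditarily_closed (\<pi> v ` H)"
  shows "hereditarily_closed H"
  unfolding hereditarily_closed_def
proof (intro allI impI, elim conjE)
  fix F N0
  assume F: "subgroup F G" "F \<subseteq> H" "fin_idx F H" and N0: "subgroup N0 G" "N0 \<subseteq> F"
    "\<forall>f\<in>F. \<forall>x\<in>N0. f \<otimes> x \<otimes> inv f \<in> N0"
  have FS: "F \<subseteq> S" using F(2) H(2) by blast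
  have Sc: "x \<in> carrier G" if "x \<in> S" for x using subgroup.mem_carrier[OF S(1) that] .
  have gh: "group_hom (G\<lparr>carrier := S\<rparr>) G (\<pi> v)" if "v \<in> J" for v
    using hom[OF that] subgroup_imp_group[OF S(1)] is_group
    by (simp add: group_hom_def group_hom_axioms_def)
  have pc: "\<pi> v x \<in> carrier G" if "v \<in> J" "x \<in> S" for v x
    using group_hom.hom_closed[OF gh[OF that(1)], of x] that by simp
  have pm: "\<pi> v (x \<otimes> y) = \<pi> v x \<otimes> \<pi> v y" if "v \<in> J" "x \<in> S" "y \<in> S" for v x y
    using hom_mult[OF hom[OF that(1)], of x y] that by simp
  have pinv: "\<pi> v (inv x) = inv (\<pi> v x)" if "v \<in> J" "x \<in> S" for v x
    using group_hom.hom_inv[OF gh[OF that(1)], of x] that m_inv_consistent[OF S(1)] by simp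
  have Sm: "x \<otimes> y \<in> S" "inv x \<in> S" if "x \<in> S" "y \<in> S" for x y
    using that S(1) by (simp_all add: subgroup.m_closed subgroup.m_inv_closed)
  have pmi: "\<pi> v (x \<otimes> inv y) = \<pi> v x \<otimes> inv (\<pi> v y)" if "v \<in> J" "x \<in> S" "y \<in> S" for v x y
    using that by (simp add: pm pinv Sm)
  have psub: "subgroup (\<pi> v ` K) G" if "v \<in> J" "subgroup K G" "K \<subseteq> S" for v K
    using group_hom.subgroup_img_is_subgroup[OF gh[OF that(1)] subgroup_incl[OF that(2) S(1) that(3)]] .
  \<comment> \<open>Induction on the set \<open>K\<close> of coordinates where \<open>N\<close> may
    be nontrivial; \<open>F\<close> stays the same throughout.\<close>
  have "\<forall>N. subgroup N G \<and> N \<subseteq> F \<and> (\<forall>f\<in>F. \<forall>x\<in>N. f \<otimes> x \<otimes> inv f \<in> N) \<and>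
      (\<forall>x\<in>N. \<forall>v\<in>J - K. \<pi> v x = \<one>) \<longrightarrow> cl N \<subseteq> N" if "finite K" "K \<subseteq> J" for K
    using that
  proof (induction K)
    case empty
    have "cl N \<subseteq> N" if N: "subgroup N G" "N \<subseteq> F" "\<forall>x\<in>N. \<forall>v\<in>J - {}. \<pi> v x = \<one>" for N
    proof -
      have "N \<subseteq> {\<one>}" using faithful N(2,3) FS by blast
      then have "N = {\<one>}" using subgroup.one_closed[OF N(1)] by blast
      then show ?thesis using cl_trivial by simp
    qed
    then show ?case by blast
  next
    case (insert v K)
    then have v: "v \<in> J" by simp
    show ?case
    proof (intro allI impI subsetI, elim conjE)
      fix N g
      assume N: "subgroup N G" "N \<subseteq> F" "\<forall>f\<in>F. \<forall>x\<in>N. f \<otimes> x \<otimes> inv f \<in> N"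
        "\<forall>x\<in>N. \<forall>v\<in>J - insert v K. \<pi> v x = \<one>" and g: "g \<in> cl N"
      have NS: "N \<subseteq> S" using N(2) FS by blast
      have gc: "g \<in> carrier G" using g by (simp add: cl_def)
      have pF: "subgroup (\<pi> v ` F) G" "\<pi> v ` F \<subseteq> \<pi> v ` H" "fin_idx (\<pi> v ` F) (\<pi> v ` H)"
      proof -
        show "subgroup (\<pi> v ` F) G" using psub[OF v F(1) FS] .
        show "\<pi> v ` F \<subseteq> \<pi> v ` H" using F(2) by (rule image_mono)
        show "fin_idx (\<pi> v ` F) (\<pi> v ` H)"
          using F(3) H(1) F(2) by (rule fin_idx_image) (use pmi[OF v] H(2) in blast)
      qed
      \<comment> \<open>The map \<open>\<pi> v\<close> sends \<open>F\<close> to a finite-index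
        subgroup of the image of \<open>H\<close>, and normal subgroups of \<open>F\<close> to
        normal subgroups of the image of \<open>F\<close>; hereditary closedness of the image of
        \<open>H\<close> applies to them.\<close>
      have pcl: "cl (\<pi> v ` K) \<subseteq> \<pi> v ` K"
        if K: "subgroup K G" "K \<subseteq> F" "\<And>f x. f \<in> F \<Longrightarrow> x \<in> K \<Longrightarrow> f \<otimes> x \<otimes> inv f \<in> K" for K
      proof -
        have "\<pi> v f \<otimes> \<pi> v x \<otimes> inv (\<pi> v f) \<in> \<pi> v ` K" if "f \<in> F" "x \<in> K" for f x
        proof -
          have "f \<in> S" "x \<in> S" using that K(2) FS by auto
          then have "\<pi> v f \<otimes> \<pi> v x \<otimes> inv (\<pi> v f) = \<pi> v (f \<otimes> x \<otimes> inv f)"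
            using v by (simp add: pm pinv Sm)
          then show ?thesis using K(3)[OF that] by simp
        qed
        then have "\<forall>f\<in>\<pi> v ` F. \<forall>x\<in>\<pi> v ` K. f \<otimes> x \<otimes> inv f \<in> \<pi> v ` K" by blast
        moreover have "subgroup (\<pi> v ` K) G" "\<pi> v ` K \<subseteq> \<pi> v ` F"
          using psub[OF v K(1)] K(2) FS by auto
        ultimately show ?thesis using hc[OF v] pF unfolding hereditarily_closed_def by blast
      qed
      \<comment> \<open>Limits stay in the open subgroup \<open>S\<close>, so \<open>\<pi> v\<close>
        behaves as a homomorphism on them as well.\<close>
      have inS: "h \<in> S" if h: "h \<in> cl N" for h
      proof -
        obtain x where x: "x \<in> N" "inv x \<otimes> h \<in> U 1" using h by (auto simp: cl_def)
        have "x \<otimes> (inv x \<otimes> h) \<in> S" using x NS S(2) Sm(1) by blast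
        moreover have "h \<in> carrier G" "x \<in> carrier G" using h x NS Sc by (auto simp: cl_def)
        ultimately show ?thesis by (simp add: m_assoc[symmetric])
      qed
      have plim: "\<exists>x\<in>N. inv x \<otimes> h \<in> U n \<and> inv (\<pi> v x) \<otimes> \<pi> v h \<in> U k" if h: "h \<in> cl N" for h n k
      proof -
        \<comment> \<open>The map \<open>\<pi> v\<close> loses one level, hence
          \<open>Suc k\<close>; the maximum serves both approximations with a single
          \<open>x\<close>.\<close>
        obtain x where x: "x \<in> N" "inv x \<otimes> h \<in> U (max n (Suc k))" using h by (auto simp: cl_def)
        have xS: "x \<in> S" "h \<in> S" using x NS inS[OF h] by auto
        have xU: "inv x \<otimes> h \<in> U n" "inv x \<otimes> h \<in> U (Suc k)"
          using x(2) U_antimono[of n "max n (Suc k)"] U_antimono[of "Suc k" "max n (Suc k)"] by auto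
        have "\<pi> v (inv x \<otimes> h) \<in> U k" using cont[OF v _ xU(2)] xS Sm by blast
        moreover have "\<pi> v (inv x \<otimes> h) = inv (\<pi> v x) \<otimes> \<pi> v h" using v xS by (simp add: pm pinv Sm)
        ultimately show ?thesis using x(1) xU(1) by auto
      qed
      have "\<pi> v g \<in> cl (\<pi> v ` N)"
        unfolding cl_def using plim[OF g] pc[OF v inS[OF g]] by blast
      then have "\<pi> v g \<in> \<pi> v ` N" using pcl[OF N(1,2)] N(3) by blast
      then obtain y where y: "y \<in> N" "\<pi> v g = \<pi> v y" by blast
      have yS: "y \<in> S" and yc: "y \<in> carrier G" using y(1) NS Sc by auto
      define g' where "g' = inv y \<otimes> g"
      have g'c: "g' \<in> carrier G" using gc yc by (simp add: g'_def)
      have pg': "\<pi> v g' = \<one>"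
        using y(2) yS inS[OF g] v pc[OF v yS] by (simp add: g'_def pm pinv Sm)
      have g'N: "g' \<in> cl N"
      proof -
        have "\<exists>x\<in>N. inv x \<otimes> g' \<in> U n" for n
        proof -
          obtain x where x: "x \<in> N" "inv x \<otimes> g \<in> U n" using g by (auto simp: cl_def)
          have xc: "x \<in> carrier G" using x(1) NS Sc by auto
          have "inv (inv y \<otimes> x) \<otimes> g' = inv x \<otimes> (y \<otimes> (inv y \<otimes> g))"
            using xc yc gc by (simp add: g'_def inv_mult_group m_assoc)
          also have "y \<otimes> (inv y \<otimes> g) = g" using yc gc by (simp add: m_assoc[symmetric])
          finally have "inv (inv y \<otimes> x) \<otimes> g' \<in> U n" using x(2) by simp
          moreover have "inv y \<otimes> x \<in> N"
            using x(1) y(1) N(1) by (simp add: subgroup.m_closed subgroup.m_inv_closed)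
          ultimately show ?thesis by blast
        qed
        then show ?thesis using g'c by (simp add: cl_def)
      qed
      define N' where "N' = {x \<in> N. \<pi> v x = \<one>}"
      have N'N: "N' \<subseteq> N" by (auto simp: N'_def)
      \<comment> \<open>An approximation \<open>x \<in> N\<close> of \<open>g'\<close> need not be
        trivial at \<open>v\<close>. Dividing by some \<open>z \<in> N \<inter> U n\<close> with the
        same image at \<open>v\<close> makes it trivial there and keeps it close to
        \<open>g'\<close>.\<close>
      have g'N': "g' \<in> cl N'"
      proof -
        have "\<exists>x\<in>N'. inv x \<otimes> g' \<in> U n" for n
        proof -
          let ?V = "U n \<inter> N"
          have V: "subgroup ?V G" using subgroups_Inter_pair[OF U_subgroup N(1)] .
          have "fin_idx ?V N"
            using fin_idx_Int[OF U_subgroup N(1) _ subset_refl U_fin_idx] subgroup.subset[OF N(1)] .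
          then have fi: "fin_idx (\<pi> v ` ?V) (\<pi> v ` N)"
            using N(1) by (rule fin_idx_image) (use pmi[OF v] NS in blast)+
          have "cl (\<pi> v ` ?V) \<subseteq> \<pi> v ` ?V"
          proof (rule pcl[OF V])
            show "?V \<subseteq> F" using N(2) by blast
            show "f \<otimes> x \<otimes> inv f \<in> ?V" if "f \<in> F" "x \<in> ?V" for f x
              using that N(3) normal.inv_op_closed2[OF U_normal] subgroup.mem_carrier[OF F(1)] by blast
          qed
          \<comment> \<open>A closed subgroup of finite index is relatively open, so elements of the
            image of \<open>N\<close> close to \<open>\<one>\<close> come from
            \<open>U n \<inter> N\<close>.\<close>
          then obtain k where k: "\<pi> v ` N \<inter> U k \<subseteq> \<pi> v ` ?V"
            using closed_fin_idx_open[OF psub[OF v V] psub[OF v N(1) NS] _ fi] NS by blast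
          obtain x where x: "x \<in> N" "inv x \<otimes> g' \<in> U n" "inv (\<pi> v x) \<otimes> \<pi> v g' \<in> U k"
            using plim[OF g'N] by blast
          have xS: "x \<in> S" and xc: "x \<in> carrier G" using x(1) NS Sc by auto
          have "inv (\<pi> v x) \<in> U k" using x(3) pg' pc[OF v xS] by simp
          then have "\<pi> v x \<in> U k" using subgroup.m_inv_closed[OF U_subgroup] pc[OF v xS] by fastforce
          then obtain z where z: "z \<in> U n" "z \<in> N" "\<pi> v x = \<pi> v z" using k x(1) by blast
          have zS: "z \<in> S" and zc: "z \<in> carrier G" using z(2) NS Sc by auto
          have "x \<otimes> inv z \<in> N" using x(1) z(2) N(1) by (simp add: subgroup.m_closed subgroup.m_inv_closed)
          moreover have "\<pi> v (x \<otimes> inv z) = \<one>" using pmi[OF v xS zS] z(3) pc[OF v zS] by simp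
          moreover have "inv (x \<otimes> inv z) \<otimes> g' = z \<otimes> (inv x \<otimes> g')"
            using xc zc g'c by (simp add: inv_mult_group m_assoc)
          moreover have "z \<otimes> (inv x \<otimes> g') \<in> U n" using subgroup.m_closed[OF U_subgroup z(1) x(2)] .
          ultimately show ?thesis unfolding N'_def by auto
        qed
        then show ?thesis using g'c by (simp add: cl_def)
      qed
      have N': "subgroup N' G"
      proof (rule subgroupI)
        show "N' \<subseteq> carrier G" using N'N subgroup.subset[OF N(1)] by blast
        have "\<pi> v \<one> = \<one>" using group_hom.hom_one[OF gh[OF v]] by simp
        then show "N' \<noteq> {}" using subgroup.one_closed[OF N(1)] by (auto simp: N'_def)
        show "inv a \<in> N'" if "a \<in> N'" for a
          using that NS pinv[OF v, of a] subgroup.m_inv_closed[OF N(1), of a] by (auto simp: N'_def)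
        show "a \<otimes> b \<in> N'" if "a \<in> N'" "b \<in> N'" for a b
          using that NS pm[OF v, of a b] subgroup.m_closed[OF N(1), of a b] by (auto simp: N'_def)
      qed
      have "\<forall>f\<in>F. \<forall>x\<in>N'. f \<otimes> x \<otimes> inv f \<in> N'"
      proof (intro ballI)
        fix f x assume fx: "f \<in> F" "x \<in> N'"
        then have S': "f \<in> S" "x \<in> S" using FS N'N NS by auto
        have "\<pi> v (f \<otimes> x \<otimes> inv f) = \<one>"
          using S' fx(2) v pc[OF v S'(1)] by (simp add: pm pinv Sm N'_def)
        then show "f \<otimes> x \<otimes> inv f \<in> N'" using N(3) fx N'N by (auto simp: N'_def)
      qed
      moreover have "\<forall>x\<in>N'. \<forall>w\<in>J - K. \<pi> w x = \<one>" using N(4) by (auto simp: N'_def)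
      moreover have "N' \<subseteq> F" using N'N N(2) by blast
      ultimately have "cl N' \<subseteq> N'" using insert.IH insert.prems N' by blast
      then have "g' \<in> N" using g'N' N'N by blast
      then have "y \<otimes> g' \<in> N" using subgroup.m_closed[OF N(1) y(1)] by blast
      then show "g \<in> N" using yc gc by (simp add: g'_def m_assoc[symmetric])
    qed
  qed
  \<comment> \<open>For \<open>K = J\<close> the triviality condition is vacuous.\<close>
  from this[OF J subset_refl] show "cl N0 \<subseteq> N0" using N0 by simp
qed

end

section \<open>The congruence topology of a group of tree automorphisms\<close>

lemma vertices_append [simp]: "v @ w \<in> vertices d \<longleftrightarrow> v \<in> vertices d \<and> w \<in> vertices d"
  by (auto simp: vertices_def)

lemma finite_level: "finite (level d n)"
proof -
  have "level d n = {xs. set xs \<subseteq> {..<d} \<and> length xs = n}"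
    by (auto simp: level_def vertices_def in_lists_conv_set)
  then show ?thesis by (simp add: finite_lists_length_eq)
qed

lemma aut_treeD:
  assumes "f \<in> carrier (Aut_tree d)"
  shows "bij_betw f (vertices d) (vertices d)" "f \<in> extensional (vertices d)" "f [] = []"
    and "u \<in> vertices d \<Longrightarrow> v \<in> vertices d \<Longrightarrow> adjacent (f u) (f v) \<longleftrightarrow> adjacent u v"
  using assms by (auto simp: Aut_tree_def Bij_def)

text \<open>Adjacency leaves two options for the image of a child of \<open>u\<close>: a child or
  the parent of \<open>f u\<close>. The latter is already the image of the parent of
  \<open>u\<close>, so injectivity excludes it.\<close>

lemma aut_tree_child:
  assumes f: "f \<in> carrier (Aut_tree d)" and v: "v \<in> vertices d"
  shows "length (f v) = length v \<and> (\<forall>u x. v = u @ [x] \<longrightarrow> (\<exists>y. f v = f u @ [y]))"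
  using v
proof (induction v rule: rev_induct)
  case Nil
  then show ?case using aut_treeD(3)[OF f] by simp
next
  case (snoc x u)
  have u: "u \<in> vertices d" "u @ [x] \<in> vertices d" using snoc.prems by auto
  note IH = snoc.IH[OF u(1)]
  have "adjacent (f u) (f (u @ [x]))"
    using aut_treeD(4)[OF f u] by (auto simp: adjacent_def)
  then consider y where "f (u @ [x]) = f u @ [y]" | y where "f u = f (u @ [x]) @ [y]"
    by (auto simp: adjacent_def)
  then have "\<exists>y. f (u @ [x]) = f u @ [y]"
  proof cases
    case 2
    then have "length u > 0" using IH by (metis length_append_singleton zero_less_Suc)
    then obtain u' z where u': "u = u' @ [z]" by (metis length_greater_0_conv rev_exhaust)
    then have "f u' = f (u @ [x])" using IH 2 by (metis append1_eq_conv)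
    moreover have "u' \<in> vertices d" using u(1) u' by simp
    ultimately have "u' = u @ [x]"
      using aut_treeD(1)[OF f] u(2) by (metis bij_betw_def inj_onD)
    then show ?thesis using u' by simp
  qed blast
  then show ?case using IH by auto
qed

lemma aut_tree_length:
  "f \<in> carrier (Aut_tree d) \<Longrightarrow> v \<in> vertices d \<Longrightarrow> length (f v) = length v"
  using aut_tree_child by blast

lemma aut_tree_append:
  assumes f: "f \<in> carrier (Aut_tree d)" and "v @ w \<in> vertices d"
  shows "\<exists>w'. f (v @ w) = f v @ w'"
  using assms(2)
proof (induction w rule: rev_induct)
  case Nil then show ?case by simp
next
  case (snoc x w)
  then obtain w' where "f (v @ w) = f v @ w'" by auto
  moreover have "\<exists>y. f ((v @ w) @ [x]) = f (v @ w) @ [y]"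
    using aut_tree_child[OF f, of "(v @ w) @ [x]"] snoc.prems by simp
  ultimately show ?case by auto
qed

text \<open>A separate name for \<open>grp d G\<close> makes the notation and results of
  \<open>group\<close> available while \<open>G\<close> remains visible as a set of maps.\<close>

locale tree_group = group \<Gamma> for \<Gamma> :: "(nat list \<Rightarrow> nat list) monoid" (structure) +
  fixes d :: nat and G :: "(nat list \<Rightarrow> nat list) set"
  assumes \<Gamma>_def: "\<Gamma> = grp d G" and G_subgroup: "subgroup G (Aut_tree d)" and d_ge: "d \<ge> 2"
begin

lemma carrier_\<Gamma> [simp]: "carrier \<Gamma> = G"
  by (simp add: \<Gamma>_def)

lemma carrier_update_G [simp]: "\<Gamma>\<lparr>carrier := G\<rparr> = \<Gamma>"
  by (simp add: \<Gamma>_def)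

section \<open>Action of the group on the vertices\<close>

lemma G_aut: "f \<in> G \<Longrightarrow> f \<in> carrier (Aut_tree d)"
  using subgroup.subset[OF G_subgroup] by blast

lemma act_mem: "f \<in> G \<Longrightarrow> v \<in> vertices d \<Longrightarrow> f v \<in> vertices d"
  using aut_treeD(1)[OF G_aut] by (auto simp: bij_betw_def)

lemma act_inj: "f \<in> G \<Longrightarrow> v \<in> vertices d \<Longrightarrow> w \<in> vertices d \<Longrightarrow> f v = f w \<Longrightarrow> v = w"
  using aut_treeD(1)[OF G_aut] by (auto simp: bij_betw_def inj_on_def)

lemma act_length: "f \<in> G \<Longrightarrow> v \<in> vertices d \<Longrightarrow> length (f v) = length v"
  using aut_tree_length[OF G_aut] .

lemma act_level: "f \<in> G \<Longrightarrow> v \<in> level d n \<Longrightarrow> f v \<in> level d n"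
  by (simp add: level_def act_mem act_length)

lemma act_append:
  assumes "f \<in> G" "v \<in> vertices d" "w \<in> vertices d"
  obtains w' where "w' \<in> vertices d" "length w' = length w" "f (v @ w) = f v @ w'"
proof -
  have vw: "v @ w \<in> vertices d" using assms by simp
  obtain w' where w': "f (v @ w) = f v @ w'" using aut_tree_append[OF G_aut[OF assms(1)] vw] by blast
  show thesis
  proof (rule that[OF _ _ w'])
    show "w' \<in> vertices d" using act_mem[OF assms(1) vw] w' by simp
    show "length w' = length w"
      using act_length[OF assms(1) vw] act_length[OF assms(1,2)] w' by simp
  qed
qed

lemma act_take: 
  assumes "f \<in> G" "v \<in> vertices d" "w \<in> vertices d" "f (v @ w) = v' @ w'" "length v' = length v"
  shows "f v = v'"
proof -
  obtain w'' where "f (v @ w) = f v @ w''" using act_append[OF assms(1-3)] by blast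
  then show ?thesis using act_length[OF assms(1,2)] assms(4,5) by simp
qed

lemma act_mult: "f \<in> G \<Longrightarrow> g \<in> G \<Longrightarrow> v \<in> vertices d \<Longrightarrow> (f \<otimes> g) v = f (g v)"
  using G_aut[of f] G_aut[of g] by (simp add: \<Gamma>_def Aut_tree_def BijGroup_def compose_def)

lemma act_one: "v \<in> vertices d \<Longrightarrow> \<one> v = v"
  by (simp add: \<Gamma>_def Aut_tree_def BijGroup_def)

lemma act_inv:
  assumes "f \<in> G" "v \<in> vertices d"
  shows "(inv f) (f v) = v" "f ((inv f) v) = v"
proof -
  have f: "f \<in> carrier \<Gamma>" "inv f \<in> G" using assms(1) inv_closed[of f] by simp_all
  show "(inv f) (f v) = v"
    using act_mult[OF f(2) assms] l_inv[OF f(1)] act_one[OF assms(2)] by simp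
  show "f ((inv f) v) = v"
    using act_mult[OF assms(1) f(2) assms(2)] r_inv[OF f(1)] act_one[OF assms(2)] by simp
qed

lemma act_eqI:
  assumes "f \<in> G" "g \<in> G" "\<And>v. v \<in> vertices d \<Longrightarrow> f v = g v"
  shows "f = g"
  using aut_treeD(2)[OF G_aut[OF assms(1)]] aut_treeD(2)[OF G_aut[OF assms(2)]] assms(3)
  by (rule extensionalityI)

lemma G_closed [simp]: "f \<in> G \<Longrightarrow> g \<in> G \<Longrightarrow> f \<otimes> g \<in> G" "f \<in> G \<Longrightarrow> inv f \<in> G" "\<one> \<in> G"
  using m_closed[of f g] inv_closed[of f] one_closed by simp_all

section \<open>Level stabilizers as a residual filtration\<close>

lemma stab_level_normal: "stab_level d G n \<lhd> \<Gamma>"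
proof -
  have lv: "v \<in> vertices d" if "v \<in> level d n" for v using that by (simp add: level_def)
  have "subgroup (stab_level d G n) \<Gamma>"
  proof (rule subgroupI)
    show "stab_level d G n \<subseteq> carrier \<Gamma>" by (auto simp: stab_level_def)
    have "\<one> \<in> stab_level d G n" using lv act_one by (simp add: stab_level_def)
    then show "stab_level d G n \<noteq> {}" by blast
    show "inv a \<in> stab_level d G n" if "a \<in> stab_level d G n" for a
    proof -
      have a: "a \<in> G" "\<And>v. v \<in> level d n \<Longrightarrow> a v = v" using that by (auto simp: stab_level_def)
      have "(inv a) v = v" if v: "v \<in> level d n" for v
        using act_inv(1)[OF a(1) lv[OF v]] a(2)[OF v] by simp
      then show ?thesis using a(1) by (simp add: stab_level_def)
    qed
    show "a \<otimes> b \<in> stab_level d G n" if "a \<in> stab_level d G n" "b \<in> stab_level d G n" for a b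
      using that lv G_closed(1) by (simp add: stab_level_def act_mult)
  qed
  moreover have "f \<otimes> x \<otimes> inv f \<in> stab_level d G n" if f: "f \<in> G" and x: "x \<in> stab_level d G n" for f x
  proof -
    have xG: "x \<in> G" using x by (simp add: stab_level_def)
    have "(f \<otimes> x \<otimes> inv f) v = v" if v: "v \<in> level d n" for v
    proof -
      have "x ((inv f) v) = (inv f) v"
        using x act_level[OF G_closed(2)[OF f] v] by (simp add: stab_level_def)
      then show ?thesis using lv[OF v] f xG act_inv(2)
        by (simp add: act_mult G_closed act_mem)
    qed
    then show ?thesis using f xG by (simp add: stab_level_def G_closed)
  qed
  ultimately show ?thesis by (simp add: normal_inv_iff)
qed

lemma inv_mult_mem_stab_level_iff:
  assumes "x \<in> G" "g \<in> G"
  shows "inv x \<otimes> g \<in> stab_level d G n \<longleftrightarrow> (\<forall>v\<in>level d n. g v = x v)"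
proof -
  have "(inv x \<otimes> g) v = v \<longleftrightarrow> g v = x v" if "v \<in> level d n" for v
  proof -
    have v: "v \<in> vertices d" using that by (simp add: level_def)
    have "(inv x) (g v) = v \<longleftrightarrow> g v = x v"
      using act_inv(2)[OF assms(1) act_mem[OF assms(2) v]] act_inv(1)[OF assms(1) v] by force
    then show ?thesis using act_mult[OF G_closed(2)[OF assms(1)] assms(2) v] by simp
  qed
  then show ?thesis using assms by (simp add: stab_level_def G_closed)
qed

lemma stab_level_antimono:
  assumes "m \<le> n"
  shows "stab_level d G n \<subseteq> stab_level d G m"
proof
  fix x assume x: "x \<in> stab_level d G n"
  have "x v = v" if v: "v \<in> level d m" for v
  proof -
    \<comment> \<open>Any extension of \<open>v\<close> down to level \<open>n\<close> would do; the
      letter \<open>0\<close> is available because \<open>d \<ge> 2\<close>.\<close>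
    let ?w = "replicate (n - m) (0::nat)"
    have w: "?w \<in> vertices d" using d_ge by (auto simp: vertices_def)
    have v': "v \<in> vertices d" using v by (simp add: level_def)
    have "v @ ?w \<in> level d n" using v w assms by (simp add: level_def)
    then have "x (v @ ?w) = v @ ?w" using x by (simp add: stab_level_def)
    then show ?thesis using act_take[OF _ v' w] x by (simp add: stab_level_def)
  qed
  then show "x \<in> stab_level d G m" using x by (simp add: stab_level_def)
qed

text \<open>Elements acting alike on the finite set \<open>level d n\<close> lie in one coset, and
  only finitely many actions are possible.\<close>

lemma stab_level_fin_idx: "fin_idx (stab_level d G n) (carrier \<Gamma>)"
proof -
  let ?r = "\<lambda>g. restrict g (level d n)"
  have "?r ` G \<subseteq> level d n \<rightarrow>\<^sub>E level d n" using act_level by auto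
  then have "finite (?r ` G)" using finite_PiE[of "level d n" "\<lambda>_. level d n"] finite_level
    by (meson finite_subset)
  then obtain T where T: "T \<subseteq> G" "finite T" "?r ` G = ?r ` T"
    using finite_subset_image[OF _ subset_refl] by metis
  have "\<exists>t\<in>T. x \<otimes> inv t \<in> stab_level d G n" if x: "x \<in> G" for x
  proof -
    have "?r x \<in> ?r ` T" using x T(3) by blast
    then obtain t where t: "t \<in> T" "?r x = ?r t" by blast
    have tG: "t \<in> G" using t(1) T(1) by blast
    have "\<forall>v\<in>level d n. x v = t v" using t(2) by (metis restrict_apply')
    then have "inv t \<otimes> x \<in> stab_level d G n" using x tG by (simp add: inv_mult_mem_stab_level_iff)
    then have "t \<otimes> (inv t \<otimes> x) \<otimes> inv t \<in> stab_level d G n"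
      using normal.inv_op_closed2[OF stab_level_normal, of t] tG by simp
    moreover have "t \<otimes> (inv t \<otimes> x) \<otimes> inv t = x \<otimes> inv t"
      using x tG by (simp add: m_assoc[symmetric])
    ultimately show ?thesis using t(1) by auto
  qed
  then show ?thesis using T unfolding fin_idx_def by (intro exI[of _ T]) simp
qed

lemma stab_level_separated: "(\<Inter>n. stab_level d G n) = {\<one>}"
proof -
  have "x = \<one>" if x: "\<And>n. x \<in> stab_level d G n" for x
  proof (rule act_eqI)
    show "x \<in> G" using x by (simp add: stab_level_def)
    show "\<one> \<in> G" using G_closed(3) .
    show "x v = \<one> v" if "v \<in> vertices d" for v
      using x[of "length v"] that by (simp add: stab_level_def level_def act_one)
  qed
  moreover have "\<one> \<in> stab_level d G n" for n
    using subgroup.one_closed[OF normal_imp_subgroup[OF stab_level_normal]] .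
  ultimately show ?thesis by blast
qed

text \<open>From here on \<open>cl\<close> is the closure in the congruence topology of
  \<open>G\<close>.\<close>

sublocale residual_filtration \<Gamma> "stab_level d G"
proof (intro residual_filtration.intro residual_filtration_axioms.intro)
qed (fact is_group | fact stab_level_normal | erule stab_level_antimono
    | fact stab_level_fin_idx | fact stab_level_separated)+

lemma cl_iff:
  assumes "N \<subseteq> G"
  shows "g \<in> cl N \<longleftrightarrow> g \<in> G \<and> (\<forall>n. \<exists>x\<in>N. \<forall>v\<in>level d n. g v = x v)"
proof -
  have "inv x \<otimes> g \<in> stab_level d G n \<longleftrightarrow> (\<forall>v\<in>level d n. g v = x v)" if "g \<in> G" "x \<in> N" for x n
    using that assms inv_mult_mem_stab_level_iff by blast
  then show ?thesis by (auto simp: cl_def)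
qed

section \<open>Sections and the first level\<close>

lemma sec_apply:
  assumes "x \<in> G" "x v = v" "v \<in> vertices d" "w \<in> vertices d"
  shows "v @ sec d v x w = x (v @ w)"
proof -
  obtain w' where "x (v @ w) = v @ w'" using act_append[OF assms(1,3,4)] assms(2) by metis
  then show ?thesis using assms(4) by (simp add: sec_def)
qed

lemma sec_mult:
  assumes v: "v \<in> vertices d" and ss: "\<And>x. x \<in> G \<Longrightarrow> x v = v \<Longrightarrow> sec d v x \<in> G"
    and x: "x \<in> G" "x v = v" and y: "y \<in> G" "y v = v"
  shows "sec d v (x \<otimes> y) = sec d v x \<otimes> sec d v y"
proof (rule act_eqI)
  have xy: "x \<otimes> y \<in> G" "(x \<otimes> y) v = v" using x y v by (simp_all add: G_closed act_mult)
  show "sec d v (x \<otimes> y) \<in> G" using ss[OF xy] .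
  show "sec d v x \<otimes> sec d v y \<in> G" using ss[OF x] ss[OF y] by (rule G_closed(1))
  fix w assume w: "w \<in> vertices d"
  have yw: "sec d v y w \<in> vertices d" using act_mem[OF ss[OF y] w] .
  have "v @ sec d v (x \<otimes> y) w = x (y (v @ w))"
    using sec_apply[OF xy v w] x y v w by (simp add: act_mult)
  also have "\<dots> = x (v @ sec d v y w)" using sec_apply[OF y v w] by simp
  also have "\<dots> = v @ sec d v x (sec d v y w)" using sec_apply[OF x v yw] by simp
  finally show "sec d v (x \<otimes> y) w = (sec d v x \<otimes> sec d v y) w"
    using w by (simp add: act_mult ss x y)
qed

text \<open>The first-level sections are the coordinates of an injective homomorphism on the first
  level stabilizer. Each costs one level of closeness, and self-similarity keeps the values in
  \<open>G\<close>.\<close>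

lemma hereditarily_closed_sections:
  assumes ss: "self_similar d G"
    and H: "subgroup H \<Gamma>" "H \<subseteq> stab_level d G 1"
    and hc: "\<And>v. v \<in> level d 1 \<Longrightarrow> hereditarily_closed (secs d v H)"
  shows "hereditarily_closed H"
proof (rule hereditarily_closed_subdirect[where S = "stab_level d G 1" and J = "level d 1" and \<pi> = "sec d"])
  let ?S = "stab_level d G 1"
  have S: "x \<in> G" "v \<in> level d 1 \<Longrightarrow> x v = v" if "x \<in> ?S" for x v
    using that by (auto simp: stab_level_def)
  have lv: "v \<in> vertices d" if "v \<in> level d 1" for v using that by (simp add: level_def)
  have secG: "sec d v x \<in> G" if "v \<in> vertices d" "x \<in> G" "x v = v" for v x
  proof -
    have "secs d v G \<subseteq> G"
      using ss that(1) subgroup.subset unfolding self_similar_def by fastforce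
    then show ?thesis using that by (auto simp: secs_def stab_def)
  qed
  show "subgroup ?S \<Gamma>" "stab_level d G 1 \<subseteq> ?S" using U_subgroup by simp_all
  show "finite (level d 1)" by (rule finite_level)
  show "sec d v \<in> hom (\<Gamma>\<lparr>carrier := ?S\<rparr>) \<Gamma>" if v: "v \<in> level d 1" for v
    using secG[OF lv[OF v]] S v sec_mult[OF lv[OF v]] by (auto simp: hom_def)
  show "sec d v x \<in> stab_level d G n"
    if v: "v \<in> level d 1" and x: "x \<in> ?S" "x \<in> stab_level d G (Suc n)" for v n x
  proof -
    have "sec d v x w = w" if w: "w \<in> level d n" for w
    proof -
      have "v @ w \<in> level d (Suc n)" using v w by (simp add: level_def)
      then have "x (v @ w) = v @ w" using x(2) by (simp add: stab_level_def)
      then show ?thesis using sec_apply[of x v w] S[OF x(1)] v lv[OF v] w by (simp add: level_def)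
    qed
    then show ?thesis using secG[OF lv[OF v]] S[OF x(1)] v by (simp add: stab_level_def)
  qed
  show "x = \<one>" if x: "x \<in> ?S" "\<And>v. v \<in> level d 1 \<Longrightarrow> sec d v x = \<one>" for x
  proof (rule act_eqI[OF S(1)[OF x(1)] G_closed(3)])
    fix u assume u: "u \<in> vertices d"
    show "x u = \<one> u"
    proof (cases u)
      case Nil
      then show ?thesis using aut_treeD(3)[OF G_aut[OF S(1)[OF x(1)]]] u act_one by simp
    next
      case (Cons a w)
      then have v: "[a] \<in> level d 1" and w: "w \<in> vertices d"
        using u by (auto simp: level_def vertices_def)
      have "[a] @ sec d [a] x w = x ([a] @ w)"
        using sec_apply[OF S(1)[OF x(1)] S(2)[OF x(1) v] lv[OF v] w] .
      then show ?thesis using x(2)[OF v] w u Cons by (simp add: act_one)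
    qed
  qed
  show "hereditarily_closed (sec d v ` H)" if v: "v \<in> level d 1" for v
  proof -
    have "stab H v = H" using H(2) S(2) v by (auto simp: stab_def)
    then show ?thesis using hc[OF v] by (simp add: secs_def)
  qed
qed (use H in auto)

text \<open>Level stabilizers are normal of finite index, so the congruence topology is coarser than
  the profinite one.\<close>

lemma closedin_profinite:
  assumes H: "subgroup H \<Gamma>" and cl: "cl H \<subseteq> H"
  shows "closedin (profinite_topology \<Gamma>) H"
proof -
  let ?B = "{N #> x | N x. N \<lhd> \<Gamma> \<and> finite_index \<Gamma> N \<and> x \<in> carrier \<Gamma>}"
  have HG: "H \<subseteq> G" using subgroup.subset[OF H] by simp
  have base: "stab_level d G n #> g \<in> ?B" if "g \<in> G" for n g
  proof -
    have "stab_level d G n \<subseteq> G" using subgroup.subset[OF U_subgroup] by simp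
    then have "finite_index \<Gamma> (stab_level d G n)"
      using finite_index_iff_fin_idx[OF U_subgroup subgroup_self, of n] U_fin_idx[of n] by simp
    moreover have "g \<in> carrier \<Gamma>" using that by simp
    ultimately show ?thesis using U_normal[of n] by blast
  qed
  have self: "g \<in> stab_level d G n #> g" if "g \<in> G" for g n
    using rcos_self[OF _ U_subgroup, of g n] that by simp
  have top: "topspace (profinite_topology \<Gamma>) = G"
  proof
    show "topspace (profinite_topology \<Gamma>) \<subseteq> G"
      unfolding profinite_topology_def topology_generated_by_topspace
    proof (rule Union_least)
      fix X assume "X \<in> ?B"
      then obtain N x where N: "X = N #> x" "N \<lhd> \<Gamma>" "x \<in> carrier \<Gamma>" by blast
      have "N \<subseteq> carrier \<Gamma>" using normal_imp_subgroup[OF N(2)] by (rule subgroup.subset)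
      then show "X \<subseteq> G" using r_coset_subset_G[OF _ N(3), of N] N(1) by simp
    qed
    show "G \<subseteq> topspace (profinite_topology \<Gamma>)"
      unfolding profinite_topology_def topology_generated_by_topspace
      using base[of _ 0] self[of _ 0] by (intro subsetI UnionI)
  qed
  have "openin (profinite_topology \<Gamma>) (G - H)"
  proof (subst openin_subopen, intro ballI)
    fix g assume g: "g \<in> G - H"
    then have "g \<notin> cl H" using cl by blast
    then obtain n where n: "\<And>x. x \<in> H \<Longrightarrow> inv x \<otimes> g \<notin> stab_level d G n"
      using g by (auto simp: cl_def)
    let ?W = "stab_level d G n #> g"
    have "openin (profinite_topology \<Gamma>) ?W"
      unfolding profinite_topology_def using base[of g n] g by (intro topology_generated_by_Basis) simp
    moreover have "?W \<subseteq> G - H"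
    proof
      fix y assume "y \<in> ?W"
      then obtain u where u: "u \<in> stab_level d G n" "y = u \<otimes> g" by (auto simp: r_coset_def)
      have uG: "u \<in> G" using u(1) by (simp add: stab_level_def)
      \<comment> \<open>For \<open>y = u g\<close> the quotient \<open>y^-1 g\<close> is a conjugate
        of \<open>u^-1\<close>, so a point of \<open>H\<close> in this coset would approximate
        \<open>g\<close> at level \<open>n\<close>.\<close>
      have "inv g \<otimes> inv u \<otimes> g \<in> stab_level d G n"
        using normal.inv_op_closed1[OF U_normal, of g "inv u"] g
          subgroup.m_inv_closed[OF U_subgroup u(1)] by simp
      moreover have "inv g \<otimes> inv u \<otimes> g = inv y \<otimes> g" using u(2) uG g by (simp add: inv_mult_group)
      ultimately have "y \<notin> H" using n by auto
      then show "y \<in> G - H" using u(2) uG g G_closed(1) by auto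
    qed
    ultimately show "\<exists>T. openin (profinite_topology \<Gamma>) T \<and> g \<in> T \<and> T \<subseteq> G - H"
      using self g by blast
  qed
  then show ?thesis using HG by (simp add: closedin_def top)
qed

end

section \<open>Branch groups\<close>

text \<open>Modulo \<open>N\<close> the generators commute, hence so does all they generate. The
  first entry is extended to words; inverting a commutator swaps the entries, and the other one is
  treated likewise.\<close>

lemma (in group) commutator_mem_normal:
  assumes N: "N \<lhd> G" and S: "S \<subseteq> carrier G"
    and comm: "\<And>s t. s \<in> S \<Longrightarrow> t \<in> S \<Longrightarrow> s \<otimes> t \<otimes> inv s \<otimes> inv t \<in> N"
    and xy: "x \<in> generate G S" "y \<in> generate G S"
  shows "x \<otimes> y \<otimes> inv x \<otimes> inv y \<in> N"
proof -
  have sN: "subgroup N G" using N by (rule normal_imp_subgroup)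
  have half: "x \<otimes> t \<otimes> inv x \<otimes> inv t \<in> N"
    if t: "t \<in> carrier G" and st: "\<And>s. s \<in> S \<Longrightarrow> s \<otimes> t \<otimes> inv s \<otimes> inv t \<in> N"
      and x: "x \<in> generate G S" for x t
    using x
  proof (induction rule: generate.induct)
    case one
    then show ?case using t subgroup.one_closed[OF sN] by simp
  next
    case (incl h)
    then show ?case by (rule st)
  next
    case (inv h)
    then have h: "h \<in> carrier G" using S by blast
    \<comment> \<open>With \<open>[x, y] = x y x^-1 y^-1\<close> one has
      \<open>[h^-1, t] = h^-1 [h, t]^-1 h\<close>.\<close>
    have "inv h \<otimes> inv (h \<otimes> t \<otimes> inv h \<otimes> inv t) \<otimes> h \<in> N"
      using normal.inv_op_closed1[OF N h subgroup.m_inv_closed[OF sN st[OF inv]]] .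
    moreover have "inv h \<otimes> inv (h \<otimes> t \<otimes> inv h \<otimes> inv t) \<otimes> h = inv h \<otimes> t \<otimes> inv (inv h) \<otimes> inv t"
      using h t by (simp add: inv_mult_group m_assoc)
    ultimately show ?case by simp
  next
    case (eng h1 h2)
    have h: "h1 \<in> carrier G" "h2 \<in> carrier G"
      using eng.hyps generate_incl[OF S] by blast+
    \<comment> \<open>This is \<open>[h1 h2, t] = h1 [h2, t] h1^-1 [h1, t]\<close>.\<close>
    have "h1 \<otimes> (h2 \<otimes> t \<otimes> inv h2 \<otimes> inv t) \<otimes> inv h1 \<otimes> (h1 \<otimes> t \<otimes> inv h1 \<otimes> inv t) \<in> N"
      using subgroup.m_closed[OF sN normal.inv_op_closed2[OF N h(1) eng.IH(2)] eng.IH(1)] .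
    moreover have "h1 \<otimes> (h2 \<otimes> t \<otimes> inv h2 \<otimes> inv t) \<otimes> inv h1 \<otimes> (h1 \<otimes> t \<otimes> inv h1 \<otimes> inv t)
        = h1 \<otimes> h2 \<otimes> t \<otimes> inv (h1 \<otimes> h2) \<otimes> inv t"
    proof -
      have "inv h1 \<otimes> (h1 \<otimes> y) = y" "inv t \<otimes> (t \<otimes> y) = y" if "y \<in> carrier G" for y
        using that h t by (simp_all add: m_assoc[symmetric])
      then show ?thesis using h t by (simp add: inv_mult_group m_assoc)
    qed
    ultimately show ?case by simp
  qed
  have flip: "inv (a \<otimes> b \<otimes> inv a \<otimes> inv b) = b \<otimes> a \<otimes> inv b \<otimes> inv a"
    if "a \<in> carrier G" "b \<in> carrier G" for a b
    using that by (simp add: inv_mult_group m_assoc)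
  have xc: "x \<in> carrier G" "y \<in> carrier G" using xy generate_incl[OF S] by blast+
  have "s \<otimes> x \<otimes> inv s \<otimes> inv x \<in> N" if s: "s \<in> S" for s
  proof -
    have sc: "s \<in> carrier G" using s S by blast
    have "x \<otimes> s \<otimes> inv x \<otimes> inv s \<in> N" using half[OF sc _ xy(1)] comm s by blast
    then have "inv (x \<otimes> s \<otimes> inv x \<otimes> inv s) \<in> N" by (rule subgroup.m_inv_closed[OF sN])
    then show ?thesis using flip[OF xc(1) sc] by simp
  qed
  then have "y \<otimes> x \<otimes> inv y \<otimes> inv x \<in> N" using half[OF xc(1) _ xy(2)] by blast
  then have "inv (y \<otimes> x \<otimes> inv y \<otimes> inv x) \<in> N" by (rule subgroup.m_inv_closed[OF sN])
  then show ?thesis using flip[OF xc(2,1)] by simp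
qed

lemma (in group) normal_in_subgroupI:
  assumes "subgroup K G" "subgroup R G" "K \<subseteq> R"
    and "\<And>f x. f \<in> R \<Longrightarrow> x \<in> K \<Longrightarrow> f \<otimes> x \<otimes> inv f \<in> K"
  shows "K \<lhd> G\<lparr>carrier := R\<rparr>"
  unfolding group.normal_inv_iff[OF subgroup_imp_group[OF assms(2)]]
  using subgroup_incl[OF assms(1-3)] assms(4) m_inv_consistent[OF assms(2)] by simp

section \<open>Rigid stabilizers and moved vertices\<close>

context tree_group
begin

text \<open>The other vertices of level \<open>m\<close> lie outside the subtree at \<open>v\<close>
  and are fixed; injectivity then forces \<open>v\<close> to be fixed too.\<close>

lemma rist_subset_stab_level:
  assumes v: "v \<in> level d m"
  shows "rist d G v \<subseteq> stab_level d G m"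
proof
  fix x assume x: "x \<in> rist d G v"
  have xG: "x \<in> G" using x by (simp add: rist_def)
  have vv: "v \<in> vertices d" using v by (simp add: level_def)
  have other: "x u = u" if "u \<in> level d m" "u \<noteq> v" for u
  proof -
    have "u \<notin> subtree d v" 
    proof
      assume "u \<in> subtree d v"
      then obtain w where "u = v @ w" unfolding subtree_def by blast
      moreover have "length u = length v" using that(1) v by (simp add: level_def)
      ultimately show False using that(2) by simp
    qed
    then have "u \<in> vertices d - subtree d v" using that(1) by (simp add: level_def)
    then show ?thesis using x by (simp add: rist_def)
  qed
  have "x v = v"
  proof (rule ccontr)
    assume ne: "x v \<noteq> v"
    have "x (x v) = x v" using other[OF act_level[OF xG v] ne] .
    then have "x v = v" by (rule act_inj[OF xG act_mem[OF xG vv] vv])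
    with ne show False ..
  qed
  then have "x u = u" if "u \<in> level d m" for u using other[OF that] by (cases "u = v") simp_all
  then show "x \<in> stab_level d G m" using xG by (simp add: stab_level_def)
qed

lemma subgroup_rist: "subgroup (rist d G v) \<Gamma>"
proof (rule subgroupI)
  show "rist d G v \<subseteq> carrier \<Gamma>" by (auto simp: rist_def)
  have "\<one> \<in> rist d G v" by (simp add: rist_def act_one)
  then show "rist d G v \<noteq> {}" by blast
  show "inv a \<in> rist d G v" if "a \<in> rist d G v" for a
  proof -
    have a: "a \<in> G" "\<And>w. w \<in> vertices d - subtree d v \<Longrightarrow> a w = w" using that by (auto simp: rist_def)
    have "(inv a) w = w" if "w \<in> vertices d - subtree d v" for w
      using act_inv(1)[OF a(1), of w] a(2)[OF that] that by simp
    then show ?thesis using a(1) by (simp add: rist_def)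
  qed
  show "a \<otimes> b \<in> rist d G v" if "a \<in> rist d G v" "b \<in> rist d G v" for a b
    using that by (simp add: rist_def act_mult)
qed

lemma rist_conj:
  assumes x: "x \<in> G" and v: "v \<in> vertices d" and a: "a \<in> rist d G v"
  shows "x \<otimes> a \<otimes> inv x \<in> rist d G (x v)"
proof -
  have aG: "a \<in> G" using a by (simp add: rist_def)
  have "(x \<otimes> a \<otimes> inv x) y = y" if y: "y \<in> vertices d" "y \<notin> subtree d (x v)" for y
  proof -
    have iy: "(inv x) y \<in> vertices d" using act_mem[OF G_closed(2)[OF x] y(1)] .
    have "(inv x) y \<notin> subtree d v"
    proof
      assume "(inv x) y \<in> subtree d v"
      then obtain w where w: "w \<in> vertices d" "(inv x) y = v @ w"
        unfolding subtree_def by blast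
      obtain w' where w': "w' \<in> vertices d" "length w' = length w" "x (v @ w) = x v @ w'"
        using act_append[OF x v w(1)] .
      have "y = x v @ w'" using act_inv(2)[OF x y(1)] w(2) w'(3) by simp
      then show False using y(2) w'(1) unfolding subtree_def by blast
    qed
    then have "a ((inv x) y) = (inv x) y" using a iy by (simp add: rist_def)
    then show ?thesis using x aG y(1) iy act_inv(2)[OF x y(1)] by (simp add: act_mult)
  qed
  then show ?thesis using x aG by (simp add: rist_def)
qed

lemma commute_of_rist:
  assumes "u \<in> level d n" "v \<in> level d n" "u \<noteq> v" "a \<in> rist d G u" "b \<in> rist d G v"
  shows "a \<otimes> b = b \<otimes> a"
  using rist_commute[OF G_subgroup assms] by (simp add: \<Gamma>_def)

text \<open>For \<open>x \<in> N\<close> moving \<open>v\<close>, the element \<open>x a\<inverse> x\<inverse>\<close> is supported away from the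
  subtree at \<open>v\<close>, so the commutators of \<open>a\<close> and of \<open>a x a\<inverse> x\<inverse> \<in> N\<close> with \<open>b\<close> agree.\<close>

lemma rist_commutator_mem:
  assumes N: "subgroup N \<Gamma>" "N \<subseteq> F" "\<And>f x. f \<in> F \<Longrightarrow> x \<in> N \<Longrightarrow> f \<otimes> x \<otimes> inv f \<in> N"
    and F: "F \<subseteq> G"
    and v: "v \<in> level d m" "rist d G v \<subseteq> F"
    and x: "x \<in> N" "x v \<noteq> v"
    and ab: "a \<in> rist d G v" "b \<in> rist d G v"
  shows "a \<otimes> b \<otimes> inv a \<otimes> inv b \<in> N"
proof -
  have vv: "v \<in> vertices d" using v(1) by (simp add: level_def)
  have c: "x \<in> G" "a \<in> G" "b \<in> G" using x(1) N(2) F ab v(2) by blast+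
  define e where "e = x \<otimes> inv a \<otimes> inv x"
  have eG: "e \<in> G" using c by (simp add: e_def)
  have "e \<in> rist d G (x v)"
    unfolding e_def using rist_conj[OF c(1) vv subgroup.m_inv_closed[OF subgroup_rist ab(1)]] .
  then have eb: "e \<otimes> b = b \<otimes> e"
    using commute_of_rist[OF act_level[OF c(1) v(1)] v(1) x(2) _ ab(2)] by blast
  have "(a \<otimes> x \<otimes> inv a) \<otimes> inv x \<in> N"
    using subgroup.m_closed[OF N(1) N(3) subgroup.m_inv_closed[OF N(1) x(1)]] ab(1) v(2) x(1) by blast
  then have aeN: "a \<otimes> e \<in> N" using c by (simp add: e_def m_assoc)
  then have "b \<otimes> inv (a \<otimes> e) \<otimes> inv b \<in> N"
    using N(3) subgroup.m_inv_closed[OF N(1)] ab(2) v(2) by blast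
  then have "a \<otimes> e \<otimes> (b \<otimes> inv (a \<otimes> e) \<otimes> inv b) \<in> N" using subgroup.m_closed[OF N(1) aeN] by blast
  moreover have "a \<otimes> e \<otimes> (b \<otimes> inv (a \<otimes> e) \<otimes> inv b) = a \<otimes> (e \<otimes> b) \<otimes> inv e \<otimes> inv a \<otimes> inv b"
    using c eG by (simp add: inv_mult_group m_assoc)
  moreover have "a \<otimes> (e \<otimes> b) \<otimes> inv e \<otimes> inv a \<otimes> inv b = a \<otimes> b \<otimes> inv a \<otimes> inv b"
    unfolding eb using c eG by (simp add: m_assoc)
  ultimately show ?thesis by simp
qed

text \<open>With \<open>v\<^sub>k = 0\<^sup>k\<close>, the set of all \<open>g\<close> such that \<open>N\<close> moves \<open>g v\<^sub>k\<close> is a union of right cosets of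
  \<open>F\<close> and grows with \<open>k\<close>; hence it stabilizes.\<close>

lemma moved_vertices_stabilize:
  assumes F: "subgroup F \<Gamma>" "fin_idx F G"
    and N: "subgroup N \<Gamma>" "N \<subseteq> F" "\<And>f x. f \<in> F \<Longrightarrow> x \<in> N \<Longrightarrow> f \<otimes> x \<otimes> inv f \<in> N"
    and trans: "\<And>n u v. u \<in> level d n \<Longrightarrow> v \<in> level d n \<Longrightarrow> \<exists>g\<in>G. g u = v"
  shows "\<exists>m\<ge>n. \<forall>u w. u \<in> level d m \<longrightarrow> w \<in> vertices d \<longrightarrow> (\<forall>x\<in>N. x u = u) \<longrightarrow>
    (\<forall>x\<in>N. x (u @ w) = u @ w)"
proof -
  define M where "M = {v \<in> vertices d. \<exists>x\<in>N. x v \<noteq> v}"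
  have FG: "F \<subseteq> G" using subgroup.subset[OF F(1)] by simp
  have NG: "N \<subseteq> G" using N(2) FG by blast
  \<comment> \<open>Normality of \<open>N\<close> in \<open>F\<close> makes the set \<open>M\<close>
    of moved vertices invariant under \<open>F\<close>.\<close>
  have MF: "f v \<in> M" if f: "f \<in> F" and v: "v \<in> M" for f v
  proof -
    obtain x where x: "x \<in> N" "x v \<noteq> v" and vv: "v \<in> vertices d" using v by (auto simp: M_def)
    have c: "f \<in> G" "x \<in> G" using f x(1) FG NG by auto
    have "(f \<otimes> x \<otimes> inv f) (f v) = f (x v)"
      using c vv act_inv(1)[OF c(1) vv] by (simp add: act_mult act_mem)
    moreover have "f (x v) \<noteq> f v" using act_inj[OF c(1) act_mem[OF c(2) vv] vv] x(2) by blast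
    ultimately show ?thesis using N(3)[OF f x(1)] act_mem[OF c(1) vv]
      unfolding M_def mem_Collect_eq by (metis (no_types))
  qed
  have Mdown: "v @ w \<in> M" if v: "v \<in> M" and w: "w \<in> vertices d" for v w
  proof -
    obtain x where x: "x \<in> N" "x v \<noteq> v" and vv: "v \<in> vertices d" using v by (auto simp: M_def)
    have "x \<in> G" using x(1) NG by blast
    then have "x (v @ w) \<noteq> v @ w" using act_take[of x v w v w] vv w x(2) by metis
    then show ?thesis using x(1) vv w by (auto simp: M_def)
  qed
  define z where "z k = replicate k (0::nat)" for k
  have z: "z k \<in> level d k" "z k \<in> vertices d" for k
    using d_ge by (auto simp: z_def level_def vertices_def)
  have zapp: "z (j + k) = z j @ z k" for j k by (simp add: z_def replicate_add)
  have up: "g (z k) \<in> M" if g: "g \<in> G" "g (z j) \<in> M" "j \<le> k" for g j k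
  proof -
    obtain w' where "w' \<in> vertices d" "length w' = length (z (k - j))"
      "g (z j @ z (k - j)) = g (z j) @ w'"
      using act_append[OF g(1) z(2) z(2)] .
    then show ?thesis using Mdown[OF g(2), of w'] zapp[of j "k - j"] g(3) by simp
  qed
  obtain T where T: "finite T" "T \<subseteq> G" "\<And>x. x \<in> G \<Longrightarrow> \<exists>t\<in>T. x \<otimes> inv t \<in> F"
    using F(2) unfolding fin_idx_def by blast
  \<comment> \<open>A level at which \<open>N\<close> moves the translate of the ray by
    \<open>t\<close>; for \<open>t\<close> without such a level the value is arbitrary and
    harmless.\<close>
  define f where "f t = (SOME j. t (z j) \<in> M)" for t
  have f: "t (z (f t)) \<in> M" if "t (z j) \<in> M" for t j
    unfolding f_def using that by (rule someI)
  define m where "m = Max (insert n (f ` T))"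
  have m: "n \<le> m" "\<And>t. t \<in> T \<Longrightarrow> f t \<le> m" using T(1) by (simp_all add: m_def)
  have "u @ w \<notin> M" if u: "u \<in> level d m" "u \<notin> M" and w: "w \<in> vertices d" for u w
  proof
    assume uw: "u @ w \<in> M"
    let ?k = "m + length w"
    have uv: "u \<in> vertices d" "length u = m" using u(1) by (simp_all add: level_def)
    have "u @ w \<in> level d ?k" using u(1) w by (simp add: level_def)
    then obtain g where g: "g \<in> G" "g (z ?k) = u @ w" using trans[OF z(1)] by blast
    obtain t where t: "t \<in> T" "g \<otimes> inv t \<in> F" using T(3)[OF g(1)] by blast
    define h where "h = g \<otimes> inv t"
    have tG: "t \<in> G" and h: "h \<in> F" "h \<in> G" using t T(2) FG by (auto simp: h_def)
    have gt: "g = h \<otimes> t" using g(1) tG by (simp add: h_def m_assoc)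
    have "(inv h) (g (z ?k)) = t (z ?k)"
      using gt h(2) tG z(2) act_inv(1)[OF h(2) act_mem[OF tG z(2)]] by (simp add: act_mult)
    then have "t (z ?k) \<in> M" using MF[OF subgroup.m_inv_closed[OF F(1) h(1)] uw] g(2) by simp
    \<comment> \<open>The ray translated by \<open>t\<close> meets \<open>M\<close> at level
      \<open>f t \<le> m\<close>, and being moved passes down the ray, so it is moved already at
      level \<open>m\<close>.\<close>
    then have "t (z m) \<in> M" using up[OF tG _ m(2)[OF t(1)]] f by blast
    then have "g (z m) \<in> M" using MF[OF h(1)] gt h(2) tG z(2) by (simp add: act_mult)
    moreover have "g (z m) = u"
      using act_take[OF g(1) z(2) z(2), of m "length w" u w] g(2) zapp uv(2) z(1)[of m]
      by (simp add: level_def)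
    ultimately show False using u(2) by simp
  qed
  then have fixed: "x (u @ w) = u @ w"
    if "u \<in> level d m" "w \<in> vertices d" "\<forall>x\<in>N. x u = u" "x \<in> N" for u w x
    using that unfolding M_def level_def by simp
  show ?thesis by (rule exI[of _ m]) (use m(1) fixed in simp)
qed

lemma open_of_fin_idx:
  assumes "congruence_subgroup_property d G" "subgroup M \<Gamma>" "fin_idx M G"
  shows "\<exists>k. stab_level d G k \<subseteq> M"
proof -
  have "M \<subseteq> G" using subgroup.subset[OF assms(2)] by simp
  then have "finite_index \<Gamma> M"
    using finite_index_iff_fin_idx[OF assms(2) subgroup_self] assms(3) by simp
  then show ?thesis
    using assms(1,2) unfolding congruence_subgroup_property_def \<Gamma>_def by blast
qed

text \<open>Finite index reduces the claim to \<open>N0 = R \<inter> N\<close>, with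
  \<open>R\<close> a level rigid stabilizer. A limit of \<open>N0\<close> outside \<open>N0\<close>
  also avoids a larger group \<open>N1\<close>, whose quotient in \<open>R\<close> is finitely
  generated abelian; an open subgroup then separates the limit from \<open>N0\<close>.\<close>

lemma hereditarily_closed_G:
  assumes fg: "fin_gen (Aut_tree d) G" and br: "branch d G" and csp: "congruence_subgroup_property d G"
  shows "hereditarily_closed G"
  unfolding hereditarily_closed_def
proof (intro allI impI, elim conjE)
  fix F N
  assume F: "subgroup F \<Gamma>" "F \<subseteq> G" "fin_idx F G" and N: "subgroup N \<Gamma>" "N \<subseteq> F"
    and Nconj': "\<forall>f\<in>F. \<forall>x\<in>N. f \<otimes> x \<otimes> inv f \<in> N"
  have Nconj: "f \<otimes> x \<otimes> inv f \<in> N" if "f \<in> F" "x \<in> N" for f x using Nconj' that by simp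
  have NG: "N \<subseteq> G" using N(2) F(2) by (rule subset_trans)
  have subG: "subgroup G \<Gamma>" using subgroup_self by simp
  have trans: "\<exists>g\<in>G. g u = v" if "u \<in> level d n" "v \<in> level d n" for n u v
    using br that unfolding branch_def by simp

  \<comment> \<open>The level \<open>m\<close> and its rigid stabilizer\<close>
  obtain n where n: "stab_level d G n \<subseteq> F" using open_of_fin_idx[OF csp F(1,3)] ..
  have "\<exists>m\<ge>n. \<forall>u w. u \<in> level d m \<longrightarrow> w \<in> vertices d \<longrightarrow> (\<forall>x\<in>N. x u = u) \<longrightarrow>
      (\<forall>x\<in>N. x (u @ w) = u @ w)"
    by (rule moved_vertices_stabilize[OF F(1,3) N(1,2)]) (fact Nconj, rule trans)
  then obtain m where m: "n \<le> m" and fixed: "\<And>u w x. u \<in> level d m \<Longrightarrow> w \<in> vertices d \<Longrightarrow>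
      (\<forall>x\<in>N. x u = u) \<Longrightarrow> x \<in> N \<Longrightarrow> x (u @ w) = u @ w"
    by blast
  \<comment> \<open>Through this inclusion the rigid stabilizers of level \<open>m\<close> lie in
    \<open>F\<close> and so normalize \<open>N\<close>.\<close>
  have mF: "stab_level d G m \<subseteq> F" using stab_level_antimono[OF m] n by (rule subset_trans)
  define Y where "Y = (\<Union>v\<in>level d m. rist d G v)"
  define R where "R = generate \<Gamma> Y"
  have Ym: "Y \<subseteq> stab_level d G m" unfolding Y_def using rist_subset_stab_level by (rule UN_least)
  have mG: "stab_level d G m \<subseteq> G" using subgroup.subset[OF U_subgroup] by simp
  have YG: "Y \<subseteq> carrier \<Gamma>" using Ym mG by simp
  have R: "subgroup R \<Gamma>" unfolding R_def using YG by (rule generate_is_subgroup)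
  have Rm: "R \<subseteq> stab_level d G m" unfolding R_def using Ym U_subgroup by (rule generate_subgroup_incl)
  have RF: "R \<subseteq> F" and RG: "R \<subseteq> G" using Rm mF mG by auto
  have ristR: "rist d G v \<subseteq> R" if "v \<in> level d m" for v
  proof
    fix a assume "a \<in> rist d G v"
    then have "a \<in> Y" using that unfolding Y_def by blast
    then show "a \<in> R" unfolding R_def by (rule generate.incl)
  qed
  have fiR: "fin_idx R G"
  proof -
    have "rist_level d G m = R"
      unfolding rist_level_def R_def Y_def[symmetric] \<Gamma>_def
      using group.generate_consistent[OF group_Aut_tree _ G_subgroup, of Y] YG by simp
    then have "finite_index \<Gamma> R" using br unfolding branch_def \<Gamma>_def by metis
    then show ?thesis using finite_index_iff_fin_idx[OF R subG RG] by simp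
  qed

  \<comment> \<open>The groups \<open>N0\<close>, \<open>Q\<close> and \<open>N1\<close>\<close>
  define N0 where "N0 = R \<inter> N"
  have N0: "subgroup N0 \<Gamma>" unfolding N0_def using subgroups_Inter_pair[OF R N(1)] .
  have N0R: "N0 \<subseteq> R" and N0N: "N0 \<subseteq> N" by (auto simp: N0_def)
  have N0conj: "f \<otimes> x \<otimes> inv f \<in> N0" if "f \<in> R" "x \<in> N0" for f x
  proof -
    have "f \<otimes> x \<otimes> inv f \<in> R"
      using that N0R R by (meson subgroup.m_closed subgroup.m_inv_closed subsetD)
    moreover have "f \<otimes> x \<otimes> inv f \<in> N" using Nconj that RF N0N by blast
    ultimately show ?thesis by (simp add: N0_def)
  qed
  define B where "B = {v \<in> level d m. \<exists>x\<in>N. x v \<noteq> v}"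
  \<comment> \<open>The elements of \<open>R\<close> supported on the subtrees that \<open>N\<close>
    fixes pointwise: they act trivially below every moved vertex of level \<open>m\<close>.\<close>
  define Q where "Q = {x \<in> R. \<forall>v\<in>B. \<forall>w\<in>vertices d. x (v @ w) = v @ w}"
  have Bm: "v \<in> level d m" "v \<in> vertices d" if "v \<in> B" for v using that by (simp_all add: B_def level_def)
  have QR: "Q \<subseteq> R" by (auto simp: Q_def)
  have Q: "subgroup Q \<Gamma>"
  proof (rule subgroupI)
    show "Q \<subseteq> carrier \<Gamma>" using QR RG by simp
    have "\<one> \<in> Q" using subgroup.one_closed[OF R] Bm(2) by (simp add: Q_def act_one)
    then show "Q \<noteq> {}" by blast
    fix a assume a: "a \<in> Q"
    have aR: "a \<in> R" "a \<in> G" using a QR RG by auto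
    have afix: "a (v @ w) = v @ w" if "v \<in> B" "w \<in> vertices d" for v w using a that by (simp add: Q_def)
    have "(inv a) (v @ w) = v @ w" if "v \<in> B" "w \<in> vertices d" for v w
    proof -
      have "(inv a) (a (v @ w)) = v @ w" using act_inv(1)[OF aR(2)] Bm(2)[OF that(1)] that(2) by simp
      then show ?thesis unfolding afix[OF that] .
    qed
    then show "inv a \<in> Q" using subgroup.m_inv_closed[OF R aR(1)] by (simp add: Q_def)
    fix b assume b: "b \<in> Q"
    have bR: "b \<in> R" "b \<in> G" using b QR RG by auto
    have bfix: "b (v @ w) = v @ w" if "v \<in> B" "w \<in> vertices d" for v w using b that by (simp add: Q_def)
    have "(a \<otimes> b) (v @ w) = v @ w" if "v \<in> B" "w \<in> vertices d" for v w
      using act_mult[OF aR(2) bR(2)] afix[OF that] bfix[OF that] Bm(2)[OF that(1)] that(2) by simp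
    then show "a \<otimes> b \<in> Q" using subgroup.m_closed[OF R aR(1) bR(1)] by (simp add: Q_def)
  qed
  have Qconj: "f \<otimes> x \<otimes> inv f \<in> Q" if f: "f \<in> R" and x: "x \<in> Q" for f x
  proof -
    have c: "f \<in> G" "x \<in> G" using f x QR RG by auto
    have "(f \<otimes> x \<otimes> inv f) (v @ w) = v @ w" if vw: "v \<in> B" "w \<in> vertices d" for v w
    proof -
      have vV: "v @ w \<in> vertices d" using Bm(2)[OF vw(1)] vw(2) by simp
      have "(inv f) v = v"
        using subgroup.m_inv_closed[OF R f] Rm Bm(1)[OF vw(1)] unfolding stab_level_def by blast
      moreover obtain w' where w': "w' \<in> vertices d" "length w' = length w"
          "(inv f) (v @ w) = (inv f) v @ w'"
        using act_append[OF G_closed(2)[OF c(1)] Bm(2)[OF vw(1)] vw(2)] .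
      ultimately have "x ((inv f) (v @ w)) = (inv f) (v @ w)" using x vw(1) by (simp add: Q_def)
      then show ?thesis
        using act_inv(2)[OF c(1) vV] act_mult[OF G_closed(1)[OF c] G_closed(2)[OF c(1)] vV]
          act_mult[OF c act_mem[OF G_closed(2)[OF c(1)] vV]] by (simp only:)
    qed
    moreover have "f \<otimes> x \<otimes> inv f \<in> R"
      using f x QR R by (meson subgroup.m_closed subgroup.m_inv_closed subsetD)
    ultimately show ?thesis by (simp add: Q_def)
  qed
  let ?\<Gamma>R = "\<Gamma>\<lparr>carrier := R\<rparr>"
  interpret R: group ?\<Gamma>R using R by (rule subgroup_imp_group)
  have invR: "inv\<^bsub>?\<Gamma>R\<^esub> x = inv x" if "x \<in> R" for x using m_inv_consistent[OF R that] .
  \<comment> \<open>\<open>N0\<close> need not contain commutators supported on the fixed subtrees;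
    the factor \<open>Q\<close> supplies them.\<close>
  define N1 where "N1 = N0 <#> Q"
  have N1: "N1 \<lhd> ?\<Gamma>R"
  proof -
    have n0: "N0 \<lhd> ?\<Gamma>R" using N0 R N0R N0conj by (rule normal_in_subgroupI)
    have q: "subgroup Q ?\<Gamma>R" using subgroup_incl[OF Q R QR] .
    have "N0 <#>\<^bsub>?\<Gamma>R\<^esub> Q = N1" by (simp add: N1_def set_mult_def)
    then have s: "subgroup N1 ?\<Gamma>R" using R.mult_norm_subgroup[OF n0 q] by simp
    then have s': "subgroup N1 \<Gamma>" "N1 \<subseteq> R" using incl_subgroup[OF R] subgroup.subset by fastforce+
    show ?thesis
    proof (rule normal_in_subgroupI[OF s'(1) R s'(2)])
      fix f y assume f: "f \<in> R" and y: "y \<in> N1"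
      obtain x q where xq: "x \<in> N0" "q \<in> Q" "y = x \<otimes> q" using y unfolding N1_def set_mult_def by blast
      have c: "f \<in> G" "x \<in> G" "q \<in> G" using f xq(1,2) N0R QR RG by auto
      have "inv f \<otimes> (f \<otimes> z) = z" if "z \<in> G" for z using that c(1) by (simp add: m_assoc[symmetric])
      then have "f \<otimes> y \<otimes> inv f = (f \<otimes> x \<otimes> inv f) \<otimes> (f \<otimes> q \<otimes> inv f)"
        using c unfolding xq(3) by (simp add: m_assoc)
      then show "f \<otimes> y \<otimes> inv f \<in> N1"
        using N0conj[OF f xq(1)] Qconj[OF f xq(2)] unfolding N1_def set_mult_def by blast
    qed
  qed
  have N0N1: "N0 \<subseteq> N1"
  proof
    fix x assume x: "x \<in> N0"
    then have "x = x \<otimes> \<one>" using N0R RG by auto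
    then show "x \<in> N1" using x subgroup.one_closed[OF Q] unfolding N1_def set_mult_def by blast
  qed
  have QN1: "Q \<subseteq> N1"
  proof
    fix x assume x: "x \<in> Q"
    then have "x = \<one> \<otimes> x" using QR RG by auto
    then show "x \<in> N1" using x subgroup.one_closed[OF N0] unfolding N1_def set_mult_def by blast
  qed

  \<comment> \<open>Commutators of \<open>R\<close> lie in \<open>N1\<close>\<close>
  have YR: "Y \<subseteq> R" unfolding R_def by (blast intro: generate.incl)
  have genR: "generate ?\<Gamma>R Y = R" by (rule generate_consistent[OF YR R, folded R_def])
  have gencomm: "a \<otimes> b \<otimes> inv a \<otimes> inv b \<in> N1" if ab: "a \<in> Y" "b \<in> Y" for a b
  proof -
    obtain u v where u: "u \<in> level d m" "a \<in> rist d G u" and v: "v \<in> level d m" "b \<in> rist d G v"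
      using ab unfolding Y_def by blast
    have abR: "a \<in> R" "b \<in> R" using ab YR by auto
    have c: "a \<in> G" "b \<in> G" using abR RG by auto
    \<comment> \<open>Three cases: rigid stabilizers of distinct vertices commute; at a moved vertex
      the commutator lies in \<open>N\<close>; at a fixed vertex both elements are already in
      \<open>Q\<close>.\<close>
    show ?thesis
    proof (cases "u = v")
      case False
      have "a \<otimes> b \<otimes> inv a \<otimes> inv b = \<one>"
        unfolding commute_of_rist[OF u(1) v(1) False u(2) v(2)] using c by (simp add: m_assoc)
      then show ?thesis using N0N1 subgroup.one_closed[OF N0] by auto
    next
      case True
      show ?thesis
      proof (cases "v \<in> B")
        case True
        then obtain x where x: "x \<in> N" "x v \<noteq> v" unfolding B_def by blast
        have rF: "rist d G v \<subseteq> F" using ristR[OF v(1)] RF by (rule subset_trans)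
        have "a \<otimes> b \<otimes> inv a \<otimes> inv b \<in> N"
          by (rule rist_commutator_mem[OF N _ F(2) v(1) rF x _ v(2)])
            (use Nconj u(2) \<open>u = v\<close> in simp_all)
        moreover have "a \<otimes> b \<otimes> inv a \<otimes> inv b \<in> R"
          using abR R by (simp add: subgroup.m_closed subgroup.m_inv_closed)
        ultimately show ?thesis using N0N1 unfolding N0_def by blast
      next
        case False
        have "x \<in> Q" if x: "x \<in> rist d G v" for x
        proof -
          have "x (u @ w) = u @ w" if uw: "u \<in> B" "w \<in> vertices d" for u w
          proof -
            have "u @ w \<notin> subtree d v"
            proof
              assume "u @ w \<in> subtree d v"
              then obtain w' where "u @ w = v @ w'" unfolding subtree_def by blast
              moreover have "length u = length v" using Bm(1)[OF uw(1)] v(1) by (simp add: level_def)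
              ultimately have "u = v" by simp
              then show False using False uw(1) by simp
            qed
            then show ?thesis using x Bm(2)[OF uw(1)] uw(2) by (simp add: rist_def)
          qed
          then show ?thesis using ristR[OF v(1)] x unfolding Q_def by blast
        qed
        then have "a \<in> Q" "b \<in> Q" using u(2) v(2) \<open>u = v\<close> by simp_all
        then have "a \<otimes> b \<otimes> inv a \<otimes> inv b \<in> Q"
          using Q by (simp add: subgroup.m_closed subgroup.m_inv_closed)
        then show ?thesis using QN1 by blast
      qed
    qed
  qed
  have commR: "x \<otimes>\<^bsub>?\<Gamma>R\<^esub> y \<otimes>\<^bsub>?\<Gamma>R\<^esub> inv\<^bsub>?\<Gamma>R\<^esub> x \<otimes>\<^bsub>?\<Gamma>R\<^esub> inv\<^bsub>?\<Gamma>R\<^esub> y \<in> N1"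
    if "x \<in> carrier ?\<Gamma>R" "y \<in> carrier ?\<Gamma>R" for x y
  proof (rule R.commutator_mem_normal[OF N1, of Y])
    show "Y \<subseteq> carrier ?\<Gamma>R" using YR by simp
    show "x \<in> generate ?\<Gamma>R Y" "y \<in> generate ?\<Gamma>R Y" using that genR by simp_all
    fix s t assume st: "s \<in> Y" "t \<in> Y"
    then have "s \<in> R" "t \<in> R" using YR by auto
    then show "s \<otimes>\<^bsub>?\<Gamma>R\<^esub> t \<otimes>\<^bsub>?\<Gamma>R\<^esub> inv\<^bsub>?\<Gamma>R\<^esub> s \<otimes>\<^bsub>?\<Gamma>R\<^esub> inv\<^bsub>?\<Gamma>R\<^esub> t \<in> N1"
      using gencomm[OF st] invR by simp
  qed

  \<comment> \<open>Finite generation of \<open>R\<close>\<close>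
  obtain E where E: "finite E" "E \<subseteq> R" "R = generate ?\<Gamma>R E"
  proof -
    obtain S where S: "finite S" "S \<subseteq> carrier (Aut_tree d)" "G = generate (Aut_tree d) S"
      using fg unfolding fin_gen_def by blast
    have SG: "S \<subseteq> G" unfolding S(3) by (blast intro: generate.incl)
    have "generate \<Gamma> S = G"
      unfolding \<Gamma>_def group.generate_consistent[OF group_Aut_tree SG G_subgroup] by (rule S(3)[symmetric])
    then have "\<exists>E. finite E \<and> E \<subseteq> R \<and> R = generate \<Gamma> E"
      using fin_idx_generate[OF S(1) _ _ R] SG fiR by simp
    then obtain E where E: "finite E" "E \<subseteq> R" "R = generate \<Gamma> E" by (elim exE conjE) (rule that)
    have "R = generate ?\<Gamma>R E" unfolding generate_consistent[OF E(2) R] by (rule E(3))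
    then show thesis by (rule that[OF E(1,2)])
  qed

  \<comment> \<open>Separating limits from \<open>N0\<close>\<close>
  have "cl N0 \<subseteq> N0"
  proof (rule subsetI, rule ccontr)
    fix g assume g: "g \<in> cl N0" and gN0: "g \<notin> N0"
    have mono: "cl N0 \<subseteq> cl K" if "N0 \<subseteq> K" for K unfolding cl_def using that by blast
    have gapprox: "\<exists>x\<in>N0. \<forall>v\<in>level d k. g v = x v" for k
      using g cl_iff[of N0 g] N0R RG by blast
    obtain k where "stab_level d G k \<subseteq> R" using open_of_fin_idx[OF csp R fiR] ..
    then have "cl R \<subseteq> R" using cl_of_open[OF R] by blast
    then have gR: "g \<in> R" using g mono[OF N0R] by blast
    then have gG: "g \<in> G" using RG by blast
    \<comment> \<open>If \<open>g = x q\<close>, then \<open>q\<close> is trivial: below moved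
      vertices by the choice of \<open>Q\<close>, below fixed ones because both \<open>x\<close> and
      the limit \<open>g\<close> act there as elements of \<open>N\<close> do, that is,
      trivially.\<close>
    have "g \<notin> N1"
    proof
      assume "g \<in> N1"
      then obtain x q where xq: "x \<in> N0" "q \<in> Q" "g = x \<otimes> q" unfolding N1_def set_mult_def by blast
      have c: "x \<in> G" "q \<in> G" using xq(1,2) N0R QR RG by auto
      have "q = \<one>"
      proof (rule act_eqI[OF c(2) G_closed(3)])
        fix y assume y: "y \<in> vertices d"
        have "q y = y"
        proof (cases "m \<le> length y")
          case False
          have "q \<in> stab_level d G (length y)"
            using xq(2) QR Rm stab_level_antimono[of "length y" m] False by auto
          then show ?thesis using y by (simp add: stab_level_def level_def)
        next
          case True
          define v w where "v = take m y" and "w = drop m y"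
          have yvw: "y = v @ w" by (simp add: v_def w_def)
          have vw: "v \<in> vertices d" "w \<in> vertices d" using y yvw by simp_all
          have vm: "v \<in> level d m" using vw(1) True by (simp add: level_def v_def)
          show ?thesis
          proof (cases "v \<in> B")
            case True
            then show ?thesis using xq(2) vw(2) yvw by (simp add: Q_def)
          next
            case False
            then have vfix: "\<forall>x\<in>N. x v = v" using vm by (simp add: B_def)
            have Nfix: "x' y = y" if "x' \<in> N" for x' using fixed[OF vm vw(2) vfix that] yvw by simp
            obtain x' where x': "x' \<in> N0" "\<forall>v\<in>level d (length y). g v = x' v" using gapprox ..
            have "g y = x' y" using x'(2) y by (simp add: level_def)
            also have "x' y = y" using x'(1) N0N Nfix by blast
            finally have "x (q y) = y" using xq(3) act_mult[OF c y] by simp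
            moreover have "x y = y" using xq(1) N0N Nfix by blast
            ultimately have "x (q y) = x y" by simp
            then show ?thesis by (rule act_inj[OF c(1) act_mem[OF c(2) y] y])
          qed
        qed
        then show "q y = \<one> y" using act_one[OF y] by simp
      qed
      then have "g = x" using xq(3) c(1) by simp
      then show False using xq(1) gN0 by simp
    qed
    \<comment> \<open>The quotient of \<open>R\<close> by \<open>N1\<close> is finitely generated
      abelian, so some finite-index subgroup contains \<open>N1\<close> and misses
      \<open>g\<close>.\<close>
    then obtain M where M: "subgroup M ?\<Gamma>R" "N1 \<subseteq> M" "g \<notin> M" "R.fin_idx M (carrier ?\<Gamma>R)"
      using R.fin_gen_abelian_quotient_separates[OF E(1) _ _ normal_imp_subgroup[OF N1] commR, of g]
        E(2,3) gR by auto
    have M': "subgroup M \<Gamma>" "M \<subseteq> R" using incl_subgroup[OF R M(1)] subgroup.subset[OF M(1)] by simp_all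
    have "fin_idx M R"
    proof -
      obtain T where T: "finite T" "T \<subseteq> R" "\<And>x. x \<in> R \<Longrightarrow> \<exists>t\<in>T. x \<otimes>\<^bsub>?\<Gamma>R\<^esub> inv\<^bsub>?\<Gamma>R\<^esub> t \<in> M"
        using M(4) unfolding R.fin_idx_def by auto
      have "\<exists>t\<in>T. x \<otimes> inv t \<in> M" if x: "x \<in> R" for x
      proof -
        obtain t where t: "t \<in> T" "x \<otimes>\<^bsub>?\<Gamma>R\<^esub> inv\<^bsub>?\<Gamma>R\<^esub> t \<in> M" using T(3)[OF x] ..
        then have "x \<otimes> inv t \<in> M" using invR[of t] T(2) by auto
        then show ?thesis using t(1) by blast
      qed
      then show ?thesis unfolding fin_idx_def using T(1,2) by blast
    qed
    \<comment> \<open>By the congruence subgroup property \<open>M\<close> is open in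
      \<open>G\<close>, hence closed; but it contains \<open>N0\<close> and misses its limit
      \<open>g\<close>.\<close>
    then have "fin_idx M G" using fin_idx_trans[OF R subG M'(1) M'(2) RG _ fiR] by blast
    then obtain k where "stab_level d G k \<subseteq> M" using open_of_fin_idx[OF csp M'(1)] by blast
    then have "cl M \<subseteq> M" using cl_of_open[OF M'(1)] by blast
    moreover have "N0 \<subseteq> M" using N0N1 M(2) by (rule subset_trans)
    ultimately show False using g mono M(3) by blast
  qed
  moreover have "fin_idx N0 N"
    unfolding N0_def using fin_idx_Int[OF R N(1) NG _ fiR] by simp
  ultimately show "cl N \<subseteq> N" using cl_of_fin_idx[OF N(1) N0 N0N] by blast
qed

end

theorem theorem2p11:
  fixes d :: nat and G :: "(nat list \<Rightarrow> nat list) set"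
  assumes "d \<ge> 2"
    and "subgroup G (Aut_tree d)"
    and "fin_gen (Aut_tree d) G"
    and "self_similar d G"
    and "branch d G"
    and "congruence_subgroup_property d G"
    and "subgroup_induction_property d G"
  shows "subgroup_separable (grp d G)"
proof -
  interpret tree_group "grp d G" d G
    using assms(1,2) group.subgroup_imp_group[OF group_Aut_tree assms(2)]
    by (simp add: tree_group_def tree_group_axioms_def)
  have G: "subgroup G (grp d G)" using subgroup_self by simp
  define \<X> where "\<X> = {H. subgroup H (grp d G) \<and> hereditarily_closed H}"
  have fi: "finite_index (grp d L) H \<longleftrightarrow> fin_idx H L"
    if "subgroup H (grp d G)" "subgroup L (grp d G)" "H \<subseteq> L" for H L
    using finite_index_iff_fin_idx[OF that] by simp
  have "inductive_family d G \<X>"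
    unfolding inductive_family_def
  proof (intro conjI allI impI ballI, goal_cases)
    case (1 H)
    then show ?case by (simp add: \<X>_def)
  next
    case 2
    have "hereditarily_closed {\<one>\<^bsub>grp d G\<^esub>}"
      unfolding hereditarily_closed_def
    proof (intro allI impI, elim conjE)
      fix F N assume "subgroup N (grp d G)" "F \<subseteq> {\<one>\<^bsub>grp d G\<^esub>}" "N \<subseteq> F"
      then have "N = {\<one>\<^bsub>grp d G\<^esub>}" using subgroup.one_closed by blast
      then show "cl N \<subseteq> N" using cl_trivial by simp
    qed
    then show ?case using triv_subgroup by (simp add: \<X>_def)
  next
    case 3
    show ?case using G hereditarily_closed_G[OF assms(3,5,6)] by (simp add: \<X>_def)
  next
    case (4 H L)
    then have HL: "subgroup H (grp d G)" "subgroup L (grp d G)" "H \<subseteq> L" "fin_idx H L"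
      using fi by blast+
    show ?case
      using HL hereditarily_closed_finite_index_subgroup[OF HL]
        hereditarily_closed_finite_index_supergroup[OF HL] unfolding \<X>_def by blast
  next
    case (5 H)
    then have H: "subgroup H (grp d G)" "H \<subseteq> stab_level d G 1"
      and hc: "\<And>v. v \<in> level d 1 \<Longrightarrow> hereditarily_closed (secs d v H)"
      by (auto simp: \<X>_def)
    show ?case using hereditarily_closed_sections[OF assms(4) H hc] H(1) by (simp add: \<X>_def)
  qed
  then have "hereditarily_closed H" if "subgroup H (grp d G)" "fin_gen (grp d G) H" for H
    using assms(7) that unfolding subgroup_induction_property_def \<X>_def by blast
  \<comment> \<open>Taking \<open>F = N = H\<close> gives closedness in the congruence topology,
    hence in the finer profinite topology.\<close>
  then show ?thesis
    unfolding subgroup_separable_def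
    using closedin_profinite hereditarily_closed_imp_closed by blast
qed

end
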